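(* Let $T>0$, $A\in C([0,T];\mathbb{R}^{n\times n})$, $B\in C([0,T];\mathbb{R}^{n\times m})$, $p\in\mathbb{R}^m$, $P\in\mathbb{S}^m_{++}$, $x_e\in\mathbb{R}^n$, $X_e\in\mathbb{S}^n_{++}$, and consider the system $\dot{x}(s)=A(s)x(s)+B(s)u(s)$ with input set $\mathbb{U}=\mathcal{E}(p,P)$ and terminal set $\mathcal{X}=\mathcal{E}(x_e,X_e)$. Let $n_q\in\mathbb{N}$ and, for each $i\in\{1,\dots,n_q\}$, let $S_i\in C([0,T];\mathbb{O}^n)$ be such that the final value problem $$\dot{q}_i(t)=A(t)q_i(t)+B(t)p,\quad \dot{Q}_i(t)=A(t)Q_i(t)+Q_i(t)A^T(t)-\underline{\mathcal{R}}_i(t,Q_i(t)),\quad q_i(T)=x_e,\ Q_i(T)=X_e$$ (for a.e. $t\in(0,T)$) has a unique solution with $Q_i(t)\in\mathbb{S}^n_{++}$ for all $t\in[0,T]$, where $$\underline{\mathcal{R}}_i(t,Q)=Q^{1/2}\big(\mathcal{Q}_\star(t,Q)^{1/2}S_i(t)+S_i(t)^T\mathcal{Q}_\star(t,Q)^{1/2}\big)Q^{1/2},\qquad \mathcal{Q}_\star(t,Q)=Q^{-1/2}B(t)PB^T(t)Q^{-1/2}.$$ Let $\{q_i,Q_i\}_{i=1}^{n_q}$ be these solutions. Then: (a) For every $t\in[0,T]$, $\underline{\mathcal{G}}(t):=\bigcup_{i=1}^{n_q}\mathcal{E}(q_i(t),Q_i(t))\subseteq\mathcal{G}(t)$. (b)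 Let $t\in[0,T]$, let $u^\star\in\mathcal{U}[t,T]$ and let $x^\star(\cdot)$ be the corresponding solution of the system on $[t,T]$ with $x^\star(T)\in\mathcal{X}$. Let $i\in\{1,\dots,n_q\}$ and set $\hat{w}_i(s)=Q_i(s)^{-1/2}(x^\star(s)-q_i(s))$ and $\mathcal{Q}_{i,\star}(s)=\mathcal{Q}_\star(s,Q_i(s))$. If $$\frac{S_i(s)\hat{w}_i(s)}{\|\hat{w}_i(s)\|_2}=\frac{\mathcal{Q}_{i,\star}(s)^{1/2}\hat{w}_i(s)}{\|\mathcal{Q}_{i,\star}(s)^{1/2}\hat{w}_i(s)\|_2}$$ for all $s\in[t,T]$ such that $\mathcal{Q}_{i,\star}(s)^{1/2}\hat{w}_i(s)\neq 0$, then $x^\star(t)\in\mathcal{E}(q_i(t),Q_i(t))\subseteq\underline{\mathcal{G}}(t)$.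
   Context: $\mathbb{S}^n_{++}$ denotes the symmetric positive definite $n\times n$ matrices, $\mathbb{O}^n$ the orthogonal $n\times n$ matrices, and for a symmetric positive semidefinite matrix $M$, $M^{1/2}$ is its symmetric positive semidefinite square root ($M^{-1/2}$ its inverse when $M$ is positive definite). For $q\in\mathbb{R}^n$, $Q\in\mathbb{S}^n_{++}$, the ellipsoid is $\mathcal{E}(q,Q)=\{x\in\mathbb{R}^n\,|\,\langle x-q,Q^{-1}(x-q)\rangle\le 1\}$. $\mathcal{U}[t,T]$ is the set of measurable maps $u:[t,T]\to\mathbb{U}$, and for $u\in\mathcal{U}[t,T]$ the corresponding solution is the absolutely continuous solution of $\dot{x}(s)=A(s)x(s)+B(s)u(s)$ for a.e. $s\in(t,T)$. The backwards reachable set is $\mathcal{G}(t)=\{x\in\mathbb{R}^n\,|\,\exists u\in\mathcal{U}[t,T]$ such that the solution with $x(t)=x$ satisfies $x(T)\in\mathcal{X}\}$. *)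

theory Defs
  imports "HOL-Analysis.Analysis"
begin

definition abs_continuous_on :: "real \<Rightarrow> real \<Rightarrow> (real \<Rightarrow> 'a::real_normed_vector) \<Rightarrow> bool" where
  "abs_continuous_on a b f \<longleftrightarrow>
     (\<forall>e>0. \<exists>d>0. \<forall>(I :: nat \<Rightarrow> real \<times> real) N.
        (\<forall>k<N. a \<le> fst (I k) \<and> fst (I k) \<le> snd (I k) \<and> snd (I k) \<le> b) \<and>
        (\<forall>j<N. \<forall>k<N. j \<noteq> k \<longrightarrow> snd (I j) \<le> fst (I k) \<or> snd (I k) \<le> fst (I j)) \<and>
        (\<Sum>k<N. snd (I k) - fst (I k)) < d
        \<longrightarrow> (\<Sum>k<N. norm (f (snd (I k)) - f (fst (I k)))) < e)"

definition psd :: "real^'n^'n \<Rightarrow> bool" where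
  "psd M \<longleftrightarrow> transpose M = M \<and> (\<forall>x. 0 \<le> x \<bullet> (M *v x))"

definition pd :: "real^'n^'n \<Rightarrow> bool" where
  "pd M \<longleftrightarrow> transpose M = M \<and> (\<forall>x. x \<noteq> 0 \<longrightarrow> 0 < x \<bullet> (M *v x))"

definition msqrt :: "real^'n^'n \<Rightarrow> real^'n^'n" where
  "msqrt M = (THE R. psd R \<and> R ** R = M)"

definition minvsqrt :: "real^'n^'n \<Rightarrow> real^'n^'n" where
  "minvsqrt M = matrix_inv (msqrt M)"

definition ellipsoid :: "real^'n \<Rightarrow> real^'n^'n \<Rightarrow> (real^'n) set" where
  "ellipsoid q Q = {x. (x - q) \<bullet> (matrix_inv Q *v (x - q)) \<le> 1}"

definition admissible :: "(real^'m) set \<Rightarrow> real \<Rightarrow> real \<Rightarrow> (real \<Rightarrow> real^'m) \<Rightarrow> bool" where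
  "admissible U t T u \<longleftrightarrow> u \<in> borel_measurable (lebesgue_on {t..T}) \<and> (\<forall>s\<in>{t..T}. u s \<in> U)"

definition sys_solution ::
  "(real \<Rightarrow> real^'n^'n) \<Rightarrow> (real \<Rightarrow> real^'m^'n) \<Rightarrow> (real \<Rightarrow> real^'m) \<Rightarrow> real \<Rightarrow> real \<Rightarrow> (real \<Rightarrow> real^'n) \<Rightarrow> bool" where
  "sys_solution A B u t T x \<longleftrightarrow> abs_continuous_on t T x \<and>
     (AE s in lborel. s \<in> {t<..<T} \<longrightarrow> (x has_vector_derivative (A s *v x s + B s *v u s)) (at s))"

definition reach_set ::
  "(real \<Rightarrow> real^'n^'n) \<Rightarrow> (real \<Rightarrow> real^'m^'n) \<Rightarrow> (real^'m) set \<Rightarrow> (real^'n) set \<Rightarrow> real \<Rightarrow> real \<Rightarrow> (real^'n) set" where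
  "reach_set A B U X T t = {x. \<exists>u. admissible U t T u \<and>
      (\<exists>xs. sys_solution A B u t T xs \<and> xs t = x \<and> xs T \<in> X)}"

definition Qstar :: "(real \<Rightarrow> real^'m^'n) \<Rightarrow> real^'m^'m \<Rightarrow> real \<Rightarrow> real^'n^'n \<Rightarrow> real^'n^'n" where
  "Qstar B P t Q = minvsqrt Q ** B t ** P ** transpose (B t) ** minvsqrt Q"

definition Rlow :: "(real \<Rightarrow> real^'m^'n) \<Rightarrow> real^'m^'m \<Rightarrow> (real \<Rightarrow> real^'n^'n) \<Rightarrow> real \<Rightarrow> real^'n^'n \<Rightarrow> real^'n^'n" where
  "Rlow B P S t Q = msqrt Q ** (msqrt (Qstar B P t Q) ** S t + transpose (S t) ** msqrt (Qstar B P t Q)) ** msqrt Q"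

definition fvp_solution ::
  "(real \<Rightarrow> real^'n^'n) \<Rightarrow> (real \<Rightarrow> real^'m^'n) \<Rightarrow> real^'m \<Rightarrow> real^'m^'m \<Rightarrow> real^'n \<Rightarrow> real^'n^'n \<Rightarrow>
   (real \<Rightarrow> real^'n^'n) \<Rightarrow> real \<Rightarrow> (real \<Rightarrow> real^'n) \<Rightarrow> (real \<Rightarrow> real^'n^'n) \<Rightarrow> bool" where
  "fvp_solution A B p P xe Xe S T q Q \<longleftrightarrow>
     abs_continuous_on 0 T q \<and> abs_continuous_on 0 T Q \<and>
     (AE t in lborel. t \<in> {0<..<T} \<longrightarrow>
        (q has_vector_derivative (A t *v q t + B t *v p)) (at t) \<and>
        (Q has_vector_derivative (A t ** Q t + Q t ** transpose (A t) - Rlow B P S t (Q t))) (at t)) \<and>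
     q T = xe \<and> Q T = Xe"

end

(*
  Let y be the deviation of a trajectory from the centre q, V = <y, Q^-1 y>, w = Q^(-1/2) y and
  K = Q_*^(1/2).  Along a trajectory the terms in A cancel and

      V' = 2 <Q^-1 y, B (u - p)> + 2 <K w, S w>.

  (a) A control with B (u - p) = - Q^(1/2) K S w makes V constant, so a trajectory that starts in
  the ellipsoid ends in the terminal set.  For such a control the deviation solves a linear ODE with
  continuous coefficients, so y comes first and the control is recovered from it: since |S w| <= 1,
  the minimal-energy solution of the equation for u - p lies in the input ellipsoid.

  (b) Under the alignment condition <K w, S w> = |K w| |w|, while the first term of V' is at least
  - 2 |K w|.  So V is nondecreasing wherever V >= 1, and a trajectory that starts outside the
  ellipsoid cannot reach V <= 1.
*)

theory Submission
  imports Defs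
begin

text \<open>Two obstacles shape the proof. \<open>B P B\<^sup>T\<close> may be singular, with a rank
  that varies in time. The first is met by the fact that the control built from a multiplier, unlike
  the multiplier, is determined by the equation it solves and is a limit of continuous functions.
  The second is met by a Hoelder estimate for the square root that does not degenerate at singular
  matrices; it gives continuity, which is all that the closed-loop equation asks for.
  \<open>V\<close> itself is differentiated through increments of \<open>Q\<close>, so no square
  root is ever differentiated.

  The other obstacle is that \<open>Q\<close> and the trajectories satisfy their equations only
  almost everywhere. The sign of the derivative of \<open>V\<close> is turned into monotonicity by
  absolute continuity and a gauge argument.\<close>

section \<open>Absolute continuity on an interval\<close>

definition disjoint_subintervals :: "real \<Rightarrow> real \<Rightarrow> (nat \<Rightarrow> real \<times> real) \<Rightarrow> nat \<Rightarrow> bool" where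
  "disjoint_subintervals a b I N \<longleftrightarrow>
     (\<forall>k<N. a \<le> fst (I k) \<and> fst (I k) \<le> snd (I k) \<and> snd (I k) \<le> b) \<and>
     (\<forall>j<N. \<forall>k<N. j \<noteq> k \<longrightarrow> snd (I j) \<le> fst (I k) \<or> snd (I k) \<le> fst (I j))"

lemma abs_continuous_on_iff:
  "abs_continuous_on a b f \<longleftrightarrow>
     (\<forall>e>0. \<exists>d>0. \<forall>I N. disjoint_subintervals a b I N \<longrightarrow> (\<Sum>k<N. snd (I k) - fst (I k)) < d
        \<longrightarrow> (\<Sum>k<N. norm (f (snd (I k)) - f (fst (I k)))) < e)"
  unfolding abs_continuous_on_def disjoint_subintervals_def
  by (simp only: conj_assoc imp_conjL)

lemma abs_continuous_on_subinterval:
  assumes "abs_continuous_on a b f" "a \<le> c" "d \<le> b"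
  shows "abs_continuous_on c d f"
  unfolding abs_continuous_on_iff
proof (intro allI impI)
  fix e :: real assume "e > 0"
  obtain \<delta> where "\<delta> > 0" and \<delta>: "\<And>(I :: nat \<Rightarrow> real \<times> real) N.
        disjoint_subintervals a b I N \<Longrightarrow>
        (\<Sum>k<N. snd (I k) - fst (I k)) < \<delta>
        \<Longrightarrow> (\<Sum>k<N. norm (f (snd (I k)) - f (fst (I k)))) < e"
    using assms(1) \<open>e > 0\<close> unfolding abs_continuous_on_iff by meson
  show "\<exists>\<delta>>0. \<forall>(I :: nat \<Rightarrow> real \<times> real) N.
        disjoint_subintervals c d I N \<longrightarrow>
        (\<Sum>k<N. snd (I k) - fst (I k)) < \<delta>
        \<longrightarrow> (\<Sum>k<N. norm (f (snd (I k)) - f (fst (I k)))) < e"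
  proof (intro exI conjI allI impI)
    show "\<delta> > 0" by fact
    fix I :: "nat \<Rightarrow> real \<times> real" and N
    assume h: "disjoint_subintervals c d I N" "(\<Sum>k<N. snd (I k) - fst (I k)) < \<delta>"
    have "disjoint_subintervals a b I N"
      using h(1) assms(2,3) unfolding disjoint_subintervals_def by force
    then show "(\<Sum>k<N. norm (f (snd (I k)) - f (fst (I k)))) < e"
      using h(2) by (rule \<delta>)
  qed
qed

text \<open>The common source of the closure properties: sums, differences, Lipschitz functions and
  the inverse quadratic form are all handled by bounding increments. The dominating functions may
  take values in different spaces, as a vector \<open>y\<close> and a matrix \<open>Q\<close>
  do.\<close>

lemma abs_continuous_on_dominated:
  fixes f :: "real \<Rightarrow> 'a::real_normed_vector" and g :: "real \<Rightarrow> 'b::real_normed_vector"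
    and h :: "real \<Rightarrow> 'c::real_normed_vector"
  assumes g: "abs_continuous_on a b g" and h: "abs_continuous_on a b h"
    and le: "\<And>u v. a \<le> u \<Longrightarrow> u \<le> v \<Longrightarrow> v \<le> b \<Longrightarrow>
               norm (f v - f u) \<le> C * norm (g v - g u) + C * norm (h v - h u)"
  shows "abs_continuous_on a b f"
  unfolding abs_continuous_on_iff
proof (intro allI impI)
  fix e :: real assume "e > 0"
  \<comment> \<open>\<open>C\<close> may have any sign, while the strict estimate at the end needs a
    positive factor.\<close>
  define K where "K = \<bar>C\<bar> + 1"
  have K: "K > 0" "C \<le> K" by (auto simp: K_def)
  define e' where "e' = e / (2 * K)"
  have e': "e' > 0" "K * e' + K * e' = e" using K \<open>e > 0\<close> by (auto simp: e'_def field_simps)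
  obtain \<delta>1 where \<delta>1: "\<delta>1 > 0" "\<And>(I :: nat \<Rightarrow> real \<times> real) N.
        disjoint_subintervals a b I N \<Longrightarrow>
        (\<Sum>k<N. snd (I k) - fst (I k)) < \<delta>1
        \<Longrightarrow> (\<Sum>k<N. norm (g (snd (I k)) - g (fst (I k)))) < e'"
    using g e'(1) unfolding abs_continuous_on_iff by meson
  obtain \<delta>2 where \<delta>2: "\<delta>2 > 0" "\<And>(I :: nat \<Rightarrow> real \<times> real) N.
        disjoint_subintervals a b I N \<Longrightarrow>
        (\<Sum>k<N. snd (I k) - fst (I k)) < \<delta>2
        \<Longrightarrow> (\<Sum>k<N. norm (h (snd (I k)) - h (fst (I k)))) < e'"
    using h e'(1) unfolding abs_continuous_on_iff by meson
  show "\<exists>\<delta>>0. \<forall>(I :: nat \<Rightarrow> real \<times> real) N.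
        disjoint_subintervals a b I N \<longrightarrow>
        (\<Sum>k<N. snd (I k) - fst (I k)) < \<delta>
        \<longrightarrow> (\<Sum>k<N. norm (f (snd (I k)) - f (fst (I k)))) < e"
  proof (intro exI conjI allI impI)
    show "min \<delta>1 \<delta>2 > 0" using \<delta>1 \<delta>2 by simp
    fix I :: "nat \<Rightarrow> real \<times> real" and N
    assume I: "disjoint_subintervals a b I N" "(\<Sum>k<N. snd (I k) - fst (I k)) < min \<delta>1 \<delta>2"
    have "(\<Sum>k<N. norm (f (snd (I k)) - f (fst (I k)))) \<le>
       (\<Sum>k<N. K * norm (g (snd (I k)) - g (fst (I k))) + K * norm (h (snd (I k)) - h (fst (I k))))"
    proof (rule sum_mono)
      fix k assume "k \<in> {..<N}"
      then have "norm (f (snd (I k)) - f (fst (I k))) \<le>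
        C * norm (g (snd (I k)) - g (fst (I k))) + C * norm (h (snd (I k)) - h (fst (I k)))"
        using I(1) by (intro le) (auto simp: disjoint_subintervals_def)
      also have "\<dots> \<le> K * norm (g (snd (I k)) - g (fst (I k))) + K * norm (h (snd (I k)) - h (fst (I k)))"
        using K by (intro add_mono mult_right_mono) auto
      finally show "norm (f (snd (I k)) - f (fst (I k))) \<le> \<dots>" .
    qed
    also have "\<dots> = K * (\<Sum>k<N. norm (g (snd (I k)) - g (fst (I k))))
        + K * (\<Sum>k<N. norm (h (snd (I k)) - h (fst (I k))))"
      by (simp add: sum.distrib sum_distrib_left)
    also have "\<dots> < K * e' + K * e'"
      using I K by (intro add_strict_mono mult_strict_left_mono \<delta>1(2) \<delta>2(2)) auto
    finally show "(\<Sum>k<N. norm (f (snd (I k)) - f (fst (I k)))) < e"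
      using e' by simp
  qed
qed

lemma abs_continuous_on_Lipschitz:
  fixes f :: "real \<Rightarrow> 'a::real_normed_vector"
  assumes "\<And>u v. a \<le> u \<Longrightarrow> u \<le> v \<Longrightarrow> v \<le> b \<Longrightarrow> norm (f v - f u) \<le> C * (v - u)"
  shows "abs_continuous_on a b f"
proof -
  have id: "abs_continuous_on a b (\<lambda>x::real. x)"
    unfolding abs_continuous_on_iff
  proof (intro allI impI)
    fix e :: real assume "e > 0"
    show "\<exists>\<delta>>0. \<forall>(I :: nat \<Rightarrow> real \<times> real) N.
        disjoint_subintervals a b I N \<longrightarrow>
        (\<Sum>k<N. snd (I k) - fst (I k)) < \<delta>
        \<longrightarrow> (\<Sum>k<N. norm (snd (I k) - fst (I k))) < e"
    proof (intro exI conjI allI impI)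
      fix I :: "nat \<Rightarrow> real \<times> real" and N
      assume "disjoint_subintervals a b I N" "(\<Sum>k<N. snd (I k) - fst (I k)) < e"
      moreover from this(1) have "(\<Sum>k<N. norm (snd (I k) - fst (I k))) = (\<Sum>k<N. snd (I k) - fst (I k))"
        by (intro sum.cong) (auto simp: disjoint_subintervals_def)
      ultimately show "(\<Sum>k<N. norm (snd (I k) - fst (I k))) < e" by simp
    qed fact
  qed
  show ?thesis
  \<comment> \<open>The identity serves as both dominating functions, so each carries half of the
    constant.\<close>
  proof (rule abs_continuous_on_dominated[OF id id])
    fix u v assume uv: "a \<le> u" "u \<le> v" "v \<le> b"
    show "norm (f v - f u) \<le> C/2 * norm (v - u) + C/2 * norm (v - u)"
      using assms[OF uv] uv by (simp add: field_simps)
  qed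
qed

lemma abs_continuous_on_add:
  fixes f g :: "real \<Rightarrow> 'a::real_normed_vector"
  assumes "abs_continuous_on a b f" "abs_continuous_on a b g"
  shows "abs_continuous_on a b (\<lambda>s. f s + g s)"
proof (rule abs_continuous_on_dominated[OF assms, where C=1])
  fix u v
  show "norm (f v + g v - (f u + g u)) \<le> 1 * norm (f v - f u) + 1 * norm (g v - g u)"
    using norm_triangle_ineq[of "f v - f u" "g v - g u"] by (simp add: add_diff_add)
qed

lemma abs_continuous_on_diff:
  fixes f g :: "real \<Rightarrow> 'a::real_normed_vector"
  assumes "abs_continuous_on a b f" "abs_continuous_on a b g"
  shows "abs_continuous_on a b (\<lambda>s. f s - g s)"
proof (rule abs_continuous_on_dominated[OF assms, where C=1])
  fix u v
  have "f v - g v - (f u - g u) = (f v - f u) - (g v - g u)" by simp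
  then show "norm (f v - g v - (f u - g u)) \<le> 1 * norm (f v - f u) + 1 * norm (g v - g u)"
    by (simp only: mult_1 norm_triangle_ineq4)
qed

lemma abs_continuous_on_imp_continuous_on:
  assumes "abs_continuous_on a b f"
  shows "continuous_on {a..b} f"
  unfolding continuous_on_iff
proof (intro ballI allI impI)
  fix x e :: real assume x: "x \<in> {a..b}" and "e > 0"
  obtain \<delta> where "\<delta> > 0" and \<delta>: "\<And>(I :: nat \<Rightarrow> real \<times> real) N.
        disjoint_subintervals a b I N \<Longrightarrow>
        (\<Sum>k<N. snd (I k) - fst (I k)) < \<delta>
        \<Longrightarrow> (\<Sum>k<N. norm (f (snd (I k)) - f (fst (I k)))) < e"
    using assms \<open>e > 0\<close> unfolding abs_continuous_on_iff by meson
  have *: "norm (f v - f u) < e" if "a \<le> u" "u \<le> v" "v \<le> b" "v - u < \<delta>" for u v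
    using \<delta>[of "\<lambda>_. (u, v)" 1] that by (simp add: disjoint_subintervals_def)
  have "dist (f y) (f x) < e" if "y \<in> {a..b}" "dist y x < \<delta>" for y
    using *[of x y] *[of y x] x that
    by (cases "x \<le> y") (auto simp: dist_norm norm_minus_commute)
  then show "\<exists>d>0. \<forall>x'\<in>{a..b}. dist x' x < d \<longrightarrow> dist (f x') (f x) < e"
    using \<open>\<delta> > 0\<close> by blast
qed

text \<open>Allows an arbitrary finite index set, so that the condition applies directly to the
  tagged intervals of a division; an enumeration of the index set reduces it to sequences.\<close>

lemma abs_continuous_on_finite_family:
  assumes f: "abs_continuous_on a b f" and "e > 0"
  shows "\<exists>\<delta>>0. \<forall>(F :: 'i set) l r. finite F \<longrightarrow> (\<forall>i\<in>F. a \<le> l i \<and> l i \<le> r i \<and> r i \<le> b) \<longrightarrow>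
       (\<forall>i\<in>F. \<forall>j\<in>F. i \<noteq> j \<longrightarrow> r i \<le> l j \<or> r j \<le> l i) \<longrightarrow>
       (\<Sum>i\<in>F. r i - l i) < \<delta> \<longrightarrow> (\<Sum>i\<in>F. norm (f (r i) - f (l i))) < e"
proof -
  obtain \<delta> where \<delta>: "\<delta> > 0" "\<And>(I :: nat \<Rightarrow> real \<times> real) N.
        disjoint_subintervals a b I N \<Longrightarrow>
        (\<Sum>k<N. snd (I k) - fst (I k)) < \<delta>
        \<Longrightarrow> (\<Sum>k<N. norm (f (snd (I k)) - f (fst (I k)))) < e"
    using f \<open>e > 0\<close> unfolding abs_continuous_on_iff by meson
  show ?thesis
  proof (intro exI conjI allI impI, rule \<delta>(1))
    fix F :: "'i set" and l r :: "'i \<Rightarrow> real"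
    assume F: "finite F" and lr: "\<forall>i\<in>F. a \<le> l i \<and> l i \<le> r i \<and> r i \<le> b"
      and disj: "\<forall>i\<in>F. \<forall>j\<in>F. i \<noteq> j \<longrightarrow> r i \<le> l j \<or> r j \<le> l i"
      and small: "(\<Sum>i\<in>F. r i - l i) < \<delta>"
    obtain h where h: "bij_betw h {..<card F} F"
      using ex_bij_betw_nat_finite[OF F] by (auto simp: atLeast0LessThan)
    define I where "I k = (l (h k), r (h k))" for k
    have inF: "k < card F \<Longrightarrow> h k \<in> F" for k using h by (auto simp: bij_betw_def)
    have inj: "j < card F \<Longrightarrow> k < card F \<Longrightarrow> j \<noteq> k \<Longrightarrow> h j \<noteq> h k" for j k
      using h by (auto simp: bij_betw_def inj_on_def)
    have "(\<Sum>k<card F. norm (f (snd (I k)) - f (fst (I k)))) < e"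
    proof (rule \<delta>(2))
      show "(\<Sum>k<card F. snd (I k) - fst (I k)) < \<delta>"
        using small sum.reindex_bij_betw[OF h, of "\<lambda>i. r i - l i"] by (simp add: I_def)
    qed (use lr inF disj inj in \<open>auto simp: I_def disjoint_subintervals_def\<close>)
    then show "(\<Sum>i\<in>F. norm (f (r i) - f (l i))) < e"
      using sum.reindex_bij_betw[OF h, of "\<lambda>i. norm (f (r i) - f (l i))"] by (simp add: I_def)
  qed
qed

section \<open>Monotonicity from an almost everywhere nonnegative derivative\<close>

text \<open>Cover the exceptional null set by an open \<open>U\<close> of measure below \<delta>.
  Choose a gauge that keeps intervals tagged in the null set inside \<open>U\<close> and makes the
  others so short that the derivative at the tag bounds the decrease by \<epsilon> times the length.
  Over a fine tagged division \<open>f a - f b\<close> telescopes: the good intervals contribute at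
  most \<open>\<epsilon> * (b - a)\<close>, and absolute continuity keeps the contribution of the
  bad ones below \<epsilon>.\<close>

lemma abs_continuous_on_mono:
  fixes f :: "real \<Rightarrow> real"
  assumes ab: "a \<le> b" and ac: "abs_continuous_on a b f"
    and deriv: "AE s in lborel. s \<in> {a<..<b} \<longrightarrow> (\<exists>d\<ge>0. (f has_vector_derivative d) (at s))"
  shows "f a \<le> f b"
proof (rule field_le_epsilon)
  fix e :: real assume "e > 0"
  \<comment> \<open>Good intervals cost \<open>\<epsilon> * (b - a)\<close> and bad ones \<epsilon>,
    which add up to \<open>e\<close>.\<close>
  define \<epsilon> where "\<epsilon> = e / (b - a + 1)"
  have eps: "\<epsilon> > 0" "\<epsilon> * (b - a) + \<epsilon> = e"
  proof -
    have "b - a + 1 > 0" using ab by simp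
    then show "\<epsilon> > 0" using \<open>e > 0\<close> by (simp add: \<epsilon>_def)
    have "\<epsilon> * (b - a) + \<epsilon> = \<epsilon> * (b - a + 1)" by (simp add: algebra_simps)
    also have "\<dots> = e" using \<open>b - a + 1 > 0\<close> by (simp add: \<epsilon>_def)
    finally show "\<epsilon> * (b - a) + \<epsilon> = e" .
  qed
  obtain \<delta> where "\<delta> > 0" and \<delta>: "\<forall>(F :: (real \<times> real set) set) l r. finite F \<longrightarrow>
       (\<forall>i\<in>F. a \<le> l i \<and> l i \<le> r i \<and> r i \<le> b) \<longrightarrow>
       (\<forall>i\<in>F. \<forall>j\<in>F. i \<noteq> j \<longrightarrow> r i \<le> l j \<or> r j \<le> l i) \<longrightarrow>
       (\<Sum>i\<in>F. r i - l i) < \<delta> \<longrightarrow> (\<Sum>i\<in>F. norm (f (r i) - f (l i))) < \<epsilon>"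
    using abs_continuous_on_finite_family[OF ac eps(1)] by (elim exE conjE that)
  from AE_E[OF deriv] obtain N0 where N0: "{s. \<not> (s \<in> {a<..<b} \<longrightarrow> (\<exists>d\<ge>0. (f has_vector_derivative d) (at s)))} \<subseteq> N0"
     "emeasure lborel N0 = 0" "N0 \<in> sets lborel"
    by auto
  \<comment> \<open>The end points join the exceptional set because the derivative is known only in
    the open interval.\<close>
  define N where "N = {a, b} \<union> N0"
  have "N0 \<in> null_sets lborel" using N0 by (auto simp: null_sets_def)
  then have N: "N \<in> null_sets lborel"
    unfolding N_def using finite_imp_null_set_lborel[of "{a, b}"] by (intro null_sets.Un) auto
  have good: "\<exists>d\<ge>0. (f has_vector_derivative d) (at s)" if "s \<in> {a..b}" "s \<notin> N" for s
  proof -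
    have "s \<in> {a<..<b}" "s \<notin> N0" using that by (auto simp: N_def)
    then show ?thesis using N0(1) by blast
  qed
  obtain U where U: "open U" "N \<subseteq> U" "emeasure lborel (U - N) < ennreal \<delta>"
    using outer_regular_lborel[of N \<delta>] N \<open>\<delta> > 0\<close> by (auto simp: null_sets_def)
  have Ud: "emeasure lborel U < ennreal \<delta>"
    using U(3) emeasure_Diff_null_set[OF N, of U] U(1) by simp
  have "\<exists>r>0. (x \<in> N \<longrightarrow> ball x r \<subseteq> U) \<and> (x \<notin> N \<longrightarrow> x \<in> {a..b} \<longrightarrow>
      (\<forall>u\<in>ball x r. \<forall>v\<in>ball x r. u \<le> x \<longrightarrow> x \<le> v \<longrightarrow> f u - f v \<le> \<epsilon> * (v - u)))" for x
  proof (cases "x \<in> N \<or> x \<notin> {a..b}")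
    case True
    then show ?thesis
      using U(1,2) unfolding open_contains_ball by (metis subsetD zero_less_one)
  next
    case False
    then obtain d where d: "d \<ge> 0" "(f has_vector_derivative d) (at x)" using good by blast
    then obtain r where r: "r > 0" "\<And>y. norm (y - x) < r \<Longrightarrow> norm (f y - f x - (y - x) *\<^sub>R d) \<le> \<epsilon> * norm (y - x)"
      using eps(1) unfolding has_vector_derivative_def has_derivative_at_alt by blast
    have "f u - f v \<le> \<epsilon> * (v - u)" if "u \<in> ball x r" "v \<in> ball x r" "u \<le> x" "x \<le> v" for u v
    proof -
      have "(u - x) * d \<le> 0" "(v - x) * d \<ge> 0"
        using that d(1) by (auto simp: mult_nonpos_nonneg)
      moreover have "\<bar>f u - f x - (u - x) * d\<bar> \<le> \<epsilon> * (x - u)" "\<bar>f v - f x - (v - x) * d\<bar> \<le> \<epsilon> * (v - x)"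
        using r(2)[of u] r(2)[of v] that by (auto simp: dist_real_def)
      ultimately have "f u - f x \<le> \<epsilon> * (x - u)" "f x - f v \<le> \<epsilon> * (v - x)" by linarith+
      then show ?thesis by (simp add: algebra_simps)
    qed
    then show ?thesis using r(1) False by blast
  qed
  then obtain r where r: "\<And>x. r x > 0" "\<And>x. x \<in> N \<Longrightarrow> ball x (r x) \<subseteq> U"
    "\<And>x u v. x \<notin> N \<Longrightarrow> x \<in> {a..b} \<Longrightarrow> u \<in> ball x (r x) \<Longrightarrow> v \<in> ball x (r x) \<Longrightarrow>
      u \<le> x \<Longrightarrow> x \<le> v \<Longrightarrow> f u - f v \<le> \<epsilon> * (v - u)"
    by metis
  have "gauge (\<lambda>x. ball x (r x))" using r(1) by (auto simp: gauge_def)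
  then obtain p where p: "p tagged_division_of {a..b}" "(\<lambda>x. ball x (r x)) fine p"
    using fine_division_exists_real by blast
  note pD = tagged_division_ofD[OF p(1)]
  \<comment> \<open>\<open>Inf\<close> and \<open>Sup\<close> are the end points in the form in
    which the telescoping sum over a division is stated.\<close>
  define l where "l i = Inf (snd i)" for i :: "real \<times> real set"
  define h where "h i = Sup (snd i)" for i :: "real \<times> real set"
  have K: "snd i = {l i..h i}" "l i \<le> fst i" "fst i \<le> h i" "a \<le> l i" "h i \<le> b"
     "l i \<in> ball (fst i) (r (fst i))" "h i \<in> ball (fst i) (r (fst i))"
     "{l i..h i} \<subseteq> ball (fst i) (r (fst i))" if ip: "i \<in> p" for i
  proof -
    obtain x K where i: "i = (x, K)" by (cases i)
    then obtain u v where uv: "K = {u..v}" using pD(4)[of x K] ip unfolding box_real by blast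
    have x: "x \<in> {u..v}" using pD(2)[of x K] that i uv by auto
    then have lh: "l i = u" "h i = v" by (auto simp: l_def h_def i uv)
    have "{u..v} \<subseteq> {a..b}" using pD(3)[of x K] that i uv by auto
    moreover have "{u..v} \<subseteq> ball x (r x)" using fineD[OF p(2), of x K] that i uv by auto
    ultimately show "snd i = {l i..h i}" "l i \<le> fst i" "fst i \<le> h i" "a \<le> l i" "h i \<le> b"
     "l i \<in> ball (fst i) (r (fst i))" "h i \<in> ball (fst i) (r (fst i))" "{l i..h i} \<subseteq> ball (fst i) (r (fst i))"
      unfolding lh using x subsetD[of "{u..v}" "ball x (r x)" u] subsetD[of "{u..v}" "ball x (r x)" v]
      by (auto simp: uv i)
  qed
  have disj: "{l i<..<h i} \<inter> {l j<..<h j} = {}" if "i \<in> p" "j \<in> p" "i \<noteq> j" for i j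
  proof -
    have "interior (snd i) \<inter> interior (snd j) = {}"
      by (rule pD(5)[of "fst i" _ "fst j"]) (use that in \<open>auto simp: prod_eq_iff\<close>)
    then show ?thesis
      by (simp only: K(1)[OF that(1)] K(1)[OF that(2)] interior_atLeastAtMost_real)
  qed
  \<comment> \<open>Degenerate intervals are left out: they contribute nothing, but a single point
    may lie inside another interval of the division, since only interiors are disjoint, and would
    break the separation of the family.\<close>
  define G where "G = {i \<in> p. fst i \<in> N \<and> l i < h i}"
  have finG: "finite G" using pD(1) by (auto simp: G_def)
  have "f a - f b = (\<Sum>i\<in>p. f (l i) - f (h i))"
    using additive_tagged_division_1[OF ab p(1), of f]
    by (simp add: l_def h_def case_prod_unfold sum_subtractf)
  also have "\<dots> = (\<Sum>i\<in>p-G. f (l i) - f (h i)) + (\<Sum>i\<in>G. f (l i) - f (h i))"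
    by (rule sum.subset_diff) (auto simp: G_def pD(1))
  also have "(\<Sum>i\<in>p-G. f (l i) - f (h i)) \<le> (\<Sum>i\<in>p-G. \<epsilon> * (h i - l i))"
  proof (rule sum_mono)
    fix i assume i: "i \<in> p - G"
    show "f (l i) - f (h i) \<le> \<epsilon> * (h i - l i)"
    proof (cases "fst i \<in> N")
      case True
      then have "l i = h i" using i K(2,3)[of i] by (auto simp: G_def)
      then show ?thesis by simp
    next
      case False
      then show ?thesis using i K[of i] by (intro r(3)[of "fst i"]) auto
    qed
  qed
  also have "\<dots> \<le> (\<Sum>i\<in>p. \<epsilon> * (h i - l i))"
  proof (rule sum_mono2)
    show "0 \<le> \<epsilon> * (h i - l i)" if "i \<in> p - (p - G)" for i
      using that K(2,3)[of i] eps(1) by auto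
  qed (use pD(1) in auto)
  also have "\<dots> = \<epsilon> * (b - a)"
    using additive_tagged_division_1[OF ab p(1), of "\<lambda>x. x"]
    by (simp add: l_def h_def case_prod_unfold flip: sum_distrib_left)
  also have "(\<Sum>i\<in>G. f (l i) - f (h i)) \<le> (\<Sum>i\<in>G. norm (f (h i) - f (l i)))"
    by (rule sum_mono) auto
  also have "\<dots> < \<epsilon>"
  proof (rule \<delta>[rule_format, OF finG])
    show "a \<le> l i \<and> l i \<le> h i \<and> h i \<le> b" if "i \<in> G" for i
      using that K[of i] by (auto simp: G_def)
    show "h i \<le> l j \<or> h j \<le> l i" if "i \<in> G" "j \<in> G" "i \<noteq> j" for i j
    proof (rule ccontr)
      assume "\<not> (h i \<le> l j \<or> h j \<le> l i)"
      then have "max (l i) (l j) < min (h i) (h j)" using that by (auto simp: G_def)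
      then obtain z where "max (l i) (l j) < z" "z < min (h i) (h j)" using dense by blast
      then show False using disj[of i j] that by (auto simp: G_def)
    qed
    have "ennreal (\<Sum>i\<in>G. h i - l i) = (\<Sum>i\<in>G. emeasure lborel {l i<..<h i})"
      by (subst sum_ennreal[symmetric]) (auto simp: G_def intro!: sum.cong)
    also have "\<dots> = emeasure lborel (\<Union>i\<in>G. {l i<..<h i})"
      using disj finG by (intro sum_emeasure) (auto simp: disjoint_family_on_def G_def)
    also have "\<dots> \<le> emeasure lborel U"
    proof (rule emeasure_mono)
      show "(\<Union>i\<in>G. {l i<..<h i}) \<subseteq> U"
      proof (rule UN_least)
        fix i assume "i \<in> G"
        then have "{l i..h i} \<subseteq> U" using K(8)[of i] r(2)[of "fst i"] by (auto simp: G_def)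
        then show "{l i<..<h i} \<subseteq> U" by force
      qed
    qed (use U in auto)
    also note Ud
    finally show "(\<Sum>i\<in>G. h i - l i) < \<delta>" by (meson ennreal_leI not_less)
  qed
  finally show "f a \<le> f b + e" using eps(2) by simp
qed

section \<open>Matrix products, transposes and inverses\<close>

lemma bounded_bilinear_matrix_vector_mult:
  "bounded_bilinear ((*v) :: real^'n^'m \<Rightarrow> real^'n \<Rightarrow> real^'m)"
  unfolding bilinear_conv_bounded_bilinear[symmetric] bilinear_def
  by (auto intro!: linearI simp: algebra_simps scaleR_matrix_vector_assoc)

lemma matrix_mult_add_left: "(A + B) ** C = A ** C + B ** C" for A B :: "real^'n^'m"
  by (simp add: matrix_matrix_mult_def vec_eq_iff algebra_simps sum.distrib)

lemma bounded_bilinear_matrix_matrix_mult: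
  "bounded_bilinear ((**) :: real^'n^'m \<Rightarrow> real^'k^'n \<Rightarrow> real^'k^'m)"
  unfolding bilinear_conv_bounded_bilinear[symmetric] bilinear_def
  by (auto intro!: linearI simp: matrix_add_ldistrib matrix_mult_add_left scalar_matrix_assoc matrix_scalar_ac)

lemmas continuous_on_matrix_vector_mult [continuous_intros] =
    bounded_bilinear.continuous_on[OF bounded_bilinear_matrix_vector_mult]
lemmas continuous_on_matrix_matrix_mult [continuous_intros] =
    bounded_bilinear.continuous_on[OF bounded_bilinear_matrix_matrix_mult]

lemma continuous_on_matrix_component:
  fixes A :: "'a::topological_space \<Rightarrow> real^'n^'m"
  assumes "continuous_on S A"
  shows "continuous_on S (\<lambda>s. A s $ i $ j)"
  by (intro continuous_on_component assms)

lemma continuous_on_matrix_transpose [continuous_intros]: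
  fixes A :: "'a::topological_space \<Rightarrow> real^'n^'m"
  assumes "continuous_on S A"
  shows "continuous_on S (\<lambda>s. transpose (A s))"
  unfolding transpose_def by (intro continuous_on_vec_lambda continuous_on_matrix_component assms)

lemma continuous_on_det:
  fixes A :: "'a::topological_space \<Rightarrow> real^'n^'n"
  assumes "\<And>i j. continuous_on S (\<lambda>s. A s $ i $ j)"
  shows "continuous_on S (\<lambda>s. det (A s))"
  unfolding det_def by (intro continuous_intros assms)

lemma inner_transpose: "(A *v x) \<bullet> y = x \<bullet> (transpose A *v y)" for A :: "real^'n^'m"
  by (metis dot_lmul_matrix vector_transpose_matrix transpose_transpose)

lemma inner_transpose': "(transpose A *v x) \<bullet> y = x \<bullet> (A *v y)" for A :: "real^'n^'m"
  using inner_transpose[of "transpose A" x y] by (simp only: transpose_transpose)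

lemma inner_symmetric:
  fixes A :: "real^'n^'n"
  assumes "transpose A = A"
  shows "(A *v x) \<bullet> y = x \<bullet> (A *v y)"
  using inner_transpose[of A x y] assms by simp

lemma matrix_inv_mult:
  fixes A :: "real^'n^'n"
  assumes "invertible A"
  shows "A ** matrix_inv A = mat 1" "matrix_inv A ** A = mat 1"
  using someI_ex[OF assms[unfolded invertible_def]] by (simp_all add: matrix_inv_def)

lemma matrix_inv_eqI:
  fixes A :: "real^'n^'n"
  assumes "A ** B = mat 1"
  shows "matrix_inv A = B"
proof -
  have "invertible A" using assms invertible_right_inverse by blast
  then show ?thesis
    by (metis assms matrix_inv_mult(2) matrix_mul_assoc matrix_mul_lid matrix_mul_rid)
qed

lemma matrix_inv_apply:
  fixes A :: "real^'n^'n"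
  assumes "invertible A"
  shows "A *v (matrix_inv A *v x) = x" "matrix_inv A *v (A *v x) = x"
  using matrix_inv_mult[OF assms]
  by (simp_all add: matrix_vector_mul_assoc)

lemma transpose_matrix_inv:
  fixes A :: "real^'n^'n"
  assumes "invertible A"
  shows "transpose (matrix_inv A) = matrix_inv (transpose A)"
  by (rule matrix_inv_eqI[symmetric]) (metis assms matrix_inv_mult(2) matrix_transpose_mul transpose_mat)

text \<open>By Cramer's rule the entries are quotients of determinants, hence of polynomials in
  continuous functions.\<close>

lemma continuous_on_matrix_inv_vector:
  fixes A :: "'a::topological_space \<Rightarrow> real^'n^'n"
  assumes A: "continuous_on S A" and inv: "\<And>s. s \<in> S \<Longrightarrow> invertible (A s)"
  shows "continuous_on S (\<lambda>s. matrix_inv (A s) *v y)"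
proof -
  have eq: "matrix_inv (A s) *v y = (\<chi> k. det(\<chi> i j. if j=k then y$i else A s$i$j) / det (A s))" if "s \<in> S" for s
    using cramer[of "A s" "matrix_inv (A s) *v y" y] matrix_inv_apply[OF inv[OF that]]
      inv[OF that] invertible_det_nz by blast
  have "continuous_on S (\<lambda>s. (\<chi> k. det(\<chi> i j. if j=k then y$i else A s$i$j) / det (A s)))"
  proof (intro continuous_on_vec_lambda continuous_on_divide continuous_on_det ballI)
    fix i j k
    show "continuous_on S (\<lambda>x. (\<chi> i j. if j = k then y $ i else A x $ i $ j) $ i $ j)"
      by (cases "j = k") (auto intro: continuous_on_matrix_component A)
  qed (use inv invertible_det_nz A in \<open>auto intro: continuous_on_matrix_component\<close>)
  then show ?thesis using eq by (simp cong: continuous_on_cong_simp)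
qed

lemma continuous_on_matrix_inv [continuous_intros]:
  fixes A :: "'a::topological_space \<Rightarrow> real^'n^'n"
  assumes A: "continuous_on S A" and inv: "\<And>s. s \<in> S \<Longrightarrow> invertible (A s)"
  shows "continuous_on S (\<lambda>s. matrix_inv (A s))"
proof -
  have "matrix_inv (A s) = (\<chi> i j. (matrix_inv (A s) *v axis j 1) $ i)" for s
    by (simp add: vec_eq_iff matrix_vector_mult_basis column_def)
  moreover have "continuous_on S (\<lambda>s. (\<chi> i j. (matrix_inv (A s) *v axis j 1) $ i))"
    by (intro continuous_on_vec_lambda continuous_on_component continuous_on_matrix_inv_vector A inv)
  ultimately show ?thesis by simp
qed

section \<open>Spectral theorem and square roots of semidefinite matrices\<close>

text \<open>A maximiser of the Rayleigh quotient over an invariant subspace is an eigenvector: the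
  directional derivative of the quotient at the maximiser vanishes.\<close>
lemma Rayleigh_maximizer_eigenvector:
  fixes M :: "real^'n^'n"
  assumes sym: "transpose M = M" and W: "subspace W" and inv: "\<And>x. x \<in> W \<Longrightarrow> M *v x \<in> W"
    and v: "v \<in> W" "norm v = 1"
    and max: "\<And>x. x \<in> W \<Longrightarrow> norm x = 1 \<Longrightarrow> x \<bullet> (M *v x) \<le> v \<bullet> (M *v v)"
  shows "M *v v = (v \<bullet> (M *v v)) *\<^sub>R v"
proof -
  define l where "l = v \<bullet> (M *v v)"
  have le: "x \<bullet> (M *v x) \<le> l * (x \<bullet> x)" if "x \<in> W" for x
  proof (cases "x = 0")
    case False
    let ?y = "(1 / norm x) *\<^sub>R x"
    have "?y \<bullet> (M *v ?y) \<le> l"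
      unfolding l_def using False W that by (intro max subspace_scale) auto
    then show ?thesis
      using False by (simp add: matrix_vector_mult_scaleR dot_square_norm power2_eq_square field_simps)
  qed simp
  define w where "w = M *v v - l *\<^sub>R v"
  have wW: "w \<in> W" using W v inv by (auto simp: w_def subspace_diff subspace_scale)
  have vv: "v \<bullet> v = 1" using v by (simp add: dot_square_norm)
  have vw: "v \<bullet> w = 0" by (simp add: w_def inner_diff_right vv l_def)
  have ww: "w \<bullet> (M *v v) = w \<bullet> w"
    using vw by (simp add: w_def inner_diff_right inner_commute)
  have "w \<bullet> w = 0"
  proof (rule ccontr)
    assume "w \<bullet> w \<noteq> 0"
    then have pos: "w \<bullet> w > 0" by (simp add: order_less_le)
    \<comment> \<open>With this \<open>t\<close> the second-order term is at most
      \<open>t * t * c = t * (w \<bullet> w)\<close>, half of the first-order term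
      \<open>2 * t * (w \<bullet> w)\<close>. The summand 1 keeps \<open>c\<close> positive.\<close>
    define c where "c = \<bar>l * (w \<bullet> w) - w \<bullet> (M *v w)\<bar> + 1"
    define t where "t = (w \<bullet> w) / c"
    have c: "c > 0" by (simp add: c_def)
    then have t: "t > 0" using pos by (simp add: t_def)
    have "(v + t *\<^sub>R w) \<bullet> (M *v (v + t *\<^sub>R w)) \<le> l * ((v + t *\<^sub>R w) \<bullet> (v + t *\<^sub>R w))"
      using W v wW by (intro le subspace_add subspace_scale) auto
    moreover have "v \<bullet> (M *v w) = w \<bullet> w"
      using inner_symmetric[OF sym, of v w] ww by (simp add: inner_commute)
    ultimately have "2 * t * (w \<bullet> w) \<le> t * t * (l * (w \<bullet> w) - w \<bullet> (M *v w))"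
      using vv vw ww by (simp add: algebra_simps inner_add_left inner_add_right l_def[symmetric] inner_commute[of w v])
    also have "\<dots> \<le> t * t * c" using t by (intro mult_left_mono) (auto simp: c_def)
    also have "\<dots> = t * (w \<bullet> w)" using c by (simp add: t_def)
    finally show False using t pos by simp
  qed
  then show ?thesis by (simp add: w_def l_def)
qed

text \<open>Compactness of the unit sphere of \<open>W\<close> provides a maximiser. Maximality is
  kept in the conclusion because \<open>psd_diff_quadratic_form_le\<close> needs the largest
  eigenvalue, not just some eigenvalue.\<close>

lemma symmetric_eigenvector_exists:
  fixes M :: "real^'n^'n"
  assumes sym: "transpose M = M" and W: "subspace W" and inv: "\<And>x. x \<in> W \<Longrightarrow> M *v x \<in> W"
    and "W \<noteq> {0}"
  obtains v where "v \<in> W" "norm v = 1" "M *v v = (v \<bullet> (M *v v)) *\<^sub>R v"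
    "\<And>x. x \<in> W \<Longrightarrow> norm x = 1 \<Longrightarrow> x \<bullet> (M *v x) \<le> v \<bullet> (M *v v)"
proof -
  have "compact (sphere 0 1 \<inter> W)"
    by (intro compact_Int_closed closed_subspace W) auto
  moreover have "sphere 0 1 \<inter> W \<noteq> {}"
  proof -
    obtain x where "x \<in> W" "x \<noteq> 0" using \<open>W \<noteq> {0}\<close> subspace_0[OF W] by blast
    then have "(1 / norm x) *\<^sub>R x \<in> sphere 0 1 \<inter> W" by (auto simp: subspace_scale[OF W])
    then show ?thesis by blast
  qed
  moreover have "continuous_on (sphere 0 1 \<inter> W) (\<lambda>x. x \<bullet> (M *v x))"
    by (intro continuous_intros)
  ultimately obtain v where v: "v \<in> sphere 0 1 \<inter> W"
    "\<forall>x\<in>sphere 0 1 \<inter> W. x \<bullet> (M *v x) \<le> v \<bullet> (M *v v)"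
    using continuous_attains_sup by blast
  then have max: "\<And>x. x \<in> W \<Longrightarrow> norm x = 1 \<Longrightarrow> x \<bullet> (M *v x) \<le> v \<bullet> (M *v v)" by auto
  then have "M *v v = (v \<bullet> (M *v v)) *\<^sub>R v"
    using v by (intro Rayleigh_maximizer_eigenvector[OF sym W inv]) auto
  then show thesis using that[of v] v(1) max by auto
qed

text \<open>The spectral theorem, relativised to an invariant subspace so that the induction on the
  dimension can pass to the orthogonal complement of an eigenvector, which symmetry keeps
  invariant.\<close>

lemma symmetric_orthonormal_eigenvectors:
  fixes M :: "real^'n^'n"
  assumes sym: "transpose M = M"
  shows "subspace W \<Longrightarrow> \<forall>x\<in>W. M *v x \<in> W \<Longrightarrow>
    \<exists>B. finite B \<and> B \<subseteq> W \<and> (\<forall>b\<in>B. \<forall>c\<in>B. b \<bullet> c = (if b = c then 1 else 0)) \<and>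
      (\<forall>b\<in>B. M *v b = (b \<bullet> (M *v b)) *\<^sub>R b) \<and> (\<forall>x\<in>W. x = (\<Sum>b\<in>B. (b \<bullet> x) *\<^sub>R b))"
proof (induction "dim W" arbitrary: W rule: less_induct)
  case less
  note W = less.prems(1) and inv = less.prems(2)[rule_format]
  show ?case
  proof (cases "W = {0}")
    case True
    then show ?thesis by (intro exI[of _ "{}"]) auto
  next
    case False
    then obtain v where v: "v \<in> W" "norm v = 1" "M *v v = (v \<bullet> (M *v v)) *\<^sub>R v"
      using symmetric_eigenvector_exists[OF sym W inv] by metis
    have vv: "v \<bullet> v = 1" using v(2) by (simp add: dot_square_norm)
    define W' where "W' = W \<inter> {x. v \<bullet> x = 0}"
    have W': "subspace W'"
      unfolding W'_def by (intro subspace_inter W subspace_hyperplane)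
    have inv': "\<forall>x\<in>W'. M *v x \<in> W'"
    proof
      fix x assume that: "x \<in> W'"
      have "v \<bullet> (M *v x) = (v \<bullet> (M *v v)) *\<^sub>R v \<bullet> x"
        using inner_symmetric[OF sym, of v x] v(3) by simp
      then show "M *v x \<in> W'" using that inv by (simp add: W'_def)
    qed
    have "W' \<subset> W"
    proof -
      have "v \<notin> W'" using vv by (simp add: W'_def)
      moreover have "W' \<subseteq> W" by (auto simp: W'_def)
      ultimately show ?thesis using v(1) by blast
    qed
    then have "dim W' < dim W"
      using W W' by (intro dim_psubset) (simp add: span_eq_iff[THEN iffD2])
    from less.hyps[OF this W' inv'] obtain B where B0: "finite B" "B \<subseteq> W'"
      "\<forall>b\<in>B. \<forall>c\<in>B. b \<bullet> c = (if b = c then 1 else 0)"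
      "\<forall>b\<in>B. M *v b = (b \<bullet> (M *v b)) *\<^sub>R b" "\<forall>x\<in>W'. x = (\<Sum>b\<in>B. (b \<bullet> x) *\<^sub>R b)"
      by (elim exE conjE that)
    note B = B0(1,2) B0(3-5)[rule_format]
    have vB: "b \<bullet> v = 0" "v \<bullet> b = 0" if "b \<in> B" for b
      using B(2) that by (auto simp: W'_def inner_commute)
    have "v \<notin> B" using vB(1)[of v] vv by auto
    have exp: "x = (\<Sum>b\<in>insert v B. (b \<bullet> x) *\<^sub>R b)" if "x \<in> W" for x
    proof -
      have "x - (v \<bullet> x) *\<^sub>R v \<in> W'"
        using that v(1) W by (simp add: W'_def subspace_diff subspace_scale inner_diff_right vv)
      from B(5)[OF this] have "x - (v \<bullet> x) *\<^sub>R v = (\<Sum>b\<in>B. (b \<bullet> x) *\<^sub>R b)"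
        by (simp add: inner_diff_right vB cong: sum.cong)
      then show ?thesis using B(1) \<open>v \<notin> B\<close> by (simp add: algebra_simps)
    qed
    show ?thesis
    proof (intro exI[of _ "insert v B"] conjI ballI)
      show "insert v B \<subseteq> W" using v(1) B(2) by (auto simp: W'_def)
      show "b \<bullet> c = (if b = c then 1 else 0)" if "b \<in> insert v B" "c \<in> insert v B" for b c
        using that B(3)[of b c] vB vv \<open>v \<notin> B\<close> by auto
      show "M *v b = (b \<bullet> (M *v b)) *\<^sub>R b" if "b \<in> insert v B" for b
        using that B(4)[of b] v(3) by auto
    qed (use B(1) exp in auto)
  qed
qed

text \<open>The spectral expansion of \<open>M\<close> with each eigenvalue replaced by its
  nonnegative root.\<close>

lemma psd_square_root_exists:
  fixes M :: "real^'n^'n"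
  assumes "psd M"
  obtains R where "psd R" "R ** R = M"
proof -
  have sym: "transpose M = M" and nonneg: "\<And>x. 0 \<le> x \<bullet> (M *v x)"
    using assms by (auto simp: psd_def)
  obtain B where B: "finite B" "\<And>b c. b \<in> B \<Longrightarrow> c \<in> B \<Longrightarrow> b \<bullet> c = (if b = c then 1 else 0)"
      "\<And>b. b \<in> B \<Longrightarrow> M *v b = (b \<bullet> (M *v b)) *\<^sub>R b" "\<And>x. x = (\<Sum>b\<in>B. (b \<bullet> x) *\<^sub>R b)"
    using symmetric_orthonormal_eigenvectors[OF sym subspace_UNIV] by auto
  define s where "s b = sqrt (b \<bullet> (M *v b))" for b
  have s: "s b \<ge> 0" "s b * s b = b \<bullet> (M *v b)" for b using nonneg by (auto simp: s_def)
  define f where "f x = (\<Sum>b\<in>B. (s b * (b \<bullet> x)) *\<^sub>R b)" for x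
  have lin: "linear f"
    unfolding f_def
    by (intro linear_compose_sum ballI linearI) (auto simp: inner_add_right algebra_simps)
  define R where "R = matrix f"
  have R: "R *v x = f x" for x using lin by (simp add: R_def)
  have xf: "x \<bullet> f y = (\<Sum>b\<in>B. s b * (b \<bullet> x) * (b \<bullet> y))" for x y
    by (simp add: f_def inner_sum_right inner_commute[of x] mult_ac)
  have bf: "b \<bullet> f x = s b * (b \<bullet> x)" if "b \<in> B" for b x
  proof -
    have "b \<bullet> f x = (\<Sum>c\<in>B. if c = b then s b * (b \<bullet> x) else 0)"
      unfolding xf using B(2) that by (intro sum.cong) auto
    then show ?thesis using B(1) that by simp
  qed
  have "transpose R *v x = R *v x" for x
  proof (rule vector_eq_rdot[THEN iffD1], rule allI)
    fix y
    have "(transpose R *v x) \<bullet> y = x \<bullet> f y"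
      using inner_transpose[of "transpose R" x y] R by simp
    also have "\<dots> = y \<bullet> f x" by (simp add: xf mult_ac)
    finally show "(transpose R *v x) \<bullet> y = (R *v x) \<bullet> y" by (simp add: R inner_commute)
  qed
  then have "transpose R = R" by (simp add: matrix_eq)
  moreover have "0 \<le> x \<bullet> (R *v x)" for x
    unfolding R xf by (intro sum_nonneg) (simp add: s(1) mult.assoc)
  ultimately have "psd R" by (simp add: psd_def)
  moreover have "(R ** R) *v x = M *v x" for x
  proof -
    have "(R ** R) *v x = f (f x)" by (simp add: R flip: matrix_vector_mul_assoc)
    also have "\<dots> = (\<Sum>b\<in>B. (b \<bullet> x) *\<^sub>R (M *v b))"
      unfolding f_def[of "f x"]
    proof (rule sum.cong)
      fix b assume b: "b \<in> B"
      have "(s b * (b \<bullet> f x)) *\<^sub>R b = (b \<bullet> x) *\<^sub>R ((s b * s b) *\<^sub>R b)"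
        by (simp add: bf[OF b] mult_ac)
      also have "\<dots> = (b \<bullet> x) *\<^sub>R (M *v b)" using B(3)[OF b] s(2) by simp
      finally show "(s b * (b \<bullet> f x)) *\<^sub>R b = (b \<bullet> x) *\<^sub>R (M *v b)" .
    qed simp
    also have "\<dots> = M *v (\<Sum>b\<in>B. (b \<bullet> x) *\<^sub>R b)"
      by (simp add: linear_sum[OF matrix_vector_mul_linear] matrix_vector_mult_scaleR)
    finally show ?thesis using B(4)[of x] by simp
  qed
  then have "R ** R = M" by (simp add: matrix_eq)
  ultimately show thesis by (rule that)
qed

lemma transpose_diff: "transpose (A - B) = transpose A - transpose B" for A B :: "real^'n^'m"
  by (simp add: transpose_def vec_eq_iff)

text \<open>Test the difference of the squares against a unit eigenvector \<open>v\<close> of \<open>R - S\<close> for its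
  largest eigenvalue \<open>\<mu>\<close>: the result is \<open>\<mu> (v \<bullet> (R + S) v)\<close>, which is at least \<open>\<mu>\<^sup>2\<close>.\<close>
lemma psd_diff_quadratic_form_le:
  fixes R S :: "real^'n^'n"
  assumes R: "psd R" and S: "psd S"
    and bound: "\<And>x. norm x = 1 \<Longrightarrow> x \<bullet> ((R ** R - S ** S) *v x) \<le> b"
    and b: "b \<ge> 0" and x: "norm x = 1"
  shows "x \<bullet> ((R - S) *v x) \<le> sqrt b"
proof -
  have symR: "transpose R = R" and symS: "transpose S = S" using R S by (auto simp: psd_def)
  then have sym: "transpose (R - S) = R - S" by (simp add: transpose_diff)
  have "(UNIV :: (real^'n) set) \<noteq> {0}" using x by (metis UNIV_I norm_zero singletonD zero_neq_one)
  then obtain v where v: "norm v = 1" "(R - S) *v v = (v \<bullet> ((R - S) *v v)) *\<^sub>R v"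
    "\<And>x. norm x = 1 \<Longrightarrow> x \<bullet> ((R - S) *v x) \<le> v \<bullet> ((R - S) *v v)"
    using symmetric_eigenvector_exists[OF sym subspace_UNIV] by auto
  define \<mu> where "\<mu> = v \<bullet> ((R - S) *v v)"
  have "\<mu> \<le> sqrt b"
  proof (cases "\<mu> \<le> 0")
    case True
    then show ?thesis using b by (meson order_trans real_sqrt_ge_zero)
  next
    case False
    have "v \<bullet> (R *v v) = v \<bullet> (S *v v) + \<mu>" by (simp add: \<mu>_def algebra_simps inner_diff_right)
    moreover have "v \<bullet> (S *v v) \<ge> 0" using S by (simp add: psd_def)
    ultimately have ge: "v \<bullet> (R *v v) + v \<bullet> (S *v v) \<ge> \<mu>" by simp
    have "\<mu> * \<mu> \<le> \<mu> * (v \<bullet> (R *v v) + v \<bullet> (S *v v))"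
      using ge False by (intro mult_left_mono) auto
    also have "\<dots> = ((R - S) *v v) \<bullet> (R *v v + S *v v)"
      using v(2) by (simp add: \<mu>_def[symmetric] inner_add_right distrib_left)
    also have "\<dots> = (R *v v) \<bullet> (R *v v) - (S *v v) \<bullet> (S *v v)"
      by (simp add: algebra_simps inner_add_right inner_diff_left inner_commute)
    also have "\<dots> = v \<bullet> ((R ** R - S ** S) *v v)"
      by (simp add: inner_symmetric[OF symR] inner_symmetric[OF symS] inner_diff_right algebra_simps
          flip: matrix_vector_mul_assoc)
    also have "\<dots> \<le> b" by (rule bound) fact
    finally show ?thesis by (simp add: real_le_rsqrt power2_eq_square)
  qed
  then show ?thesis using v(3)[OF x] by (simp add: \<mu>_def)
qed

text \<open>The square root is Hoelder continuous with exponent 1/2, with a constant that is uniform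
  up to singular matrices. One estimate serves twice: equal squares give uniqueness of the root,
  converging squares give its continuity. The quadratic form of \<open>R - S\<close> is bounded from
  both sides by exchanging \<open>R\<close> and \<open>S\<close>, and polarisation passes to the
  entries.\<close>

lemma psd_square_root_Hoelder:
  obtains C where "C \<ge> 0"
    "\<And>R S :: real^'n^'n. psd R \<Longrightarrow> psd S \<Longrightarrow> \<bar>(R - S) $ i $ j\<bar> \<le> sqrt (C * norm (R ** R - S ** S))"
proof -
  obtain C where C: "C > 0" "\<And>(A :: real^'n^'n) (x :: real^'n). norm (A *v x) \<le> norm A * norm x * C"
    using bounded_bilinear.pos_bounded[OF bounded_bilinear_matrix_vector_mult] by blast
  have quad: "x \<bullet> (A *v x) \<le> C * norm A" if "norm x = 1" for A :: "real^'n^'n" and x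
    using norm_cauchy_schwarz[of x "A *v x"] C(2)[of A x] that by (simp add: mult.commute)
  show thesis
  proof (rule that[of C])
    fix R S :: "real^'n^'n" assume R: "psd R" and S: "psd S"
    define D where "D = R - S"
    define b where "b = sqrt (C * norm (R ** R - S ** S))"
    have sym: "transpose D = D" using R S by (simp add: D_def psd_def transpose_diff)
    have up: "x \<bullet> (D *v x) \<le> b" "- (x \<bullet> (D *v x)) \<le> b" if "norm x = 1" for x
    proof -
      show "x \<bullet> (D *v x) \<le> b"
        unfolding D_def b_def using C(1) that
        by (intro psd_diff_quadratic_form_le R S quad) auto
      have "x \<bullet> ((S - R) *v x) \<le> b"
        unfolding b_def norm_minus_commute[of "R ** R"] using C(1) that
        by (intro psd_diff_quadratic_form_le R S quad) auto
      then show "- (x \<bullet> (D *v x)) \<le> b"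
        by (simp add: D_def algebra_simps inner_diff_right)
    qed
    have b: "\<bar>x \<bullet> (D *v x)\<bar> \<le> b * (norm x)\<^sup>2" for x
    proof (cases "x = 0")
      case False
      define y where "y = (1 / norm x) *\<^sub>R x"
      have y: "norm y = 1" "x = norm x *\<^sub>R y" using False by (auto simp: y_def)
      have "x \<bullet> (D *v x) = (norm x)\<^sup>2 * (y \<bullet> (D *v y))"
        by (subst y(2), subst (2) y(2)) (simp add: matrix_vector_mult_scaleR power2_eq_square)
      moreover have "\<bar>y \<bullet> (D *v y)\<bar> \<le> b" using up[OF y(1)] by linarith
      ultimately show ?thesis
        using mult_right_mono[of "\<bar>y \<bullet> (D *v y)\<bar>" b "(norm x)\<^sup>2"] by (simp add: abs_mult mult.commute)
    qed simp
    define x y :: "real^'n" where "x = axis i 1" and "y = axis j 1"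
    have xy: "norm x = 1" "norm y = 1" by (auto simp: x_def y_def)
    \<comment> \<open>Polarisation; by the parallelogram law the two bounds add up to
      \<open>4 * b\<close> for unit vectors.\<close>
    have "(x + y) \<bullet> (D *v (x + y)) - (x - y) \<bullet> (D *v (x - y)) = 4 * (x \<bullet> (D *v y))"
      using inner_symmetric[OF sym, of x y]
      by (simp add: algebra_simps inner_add_left inner_add_right inner_diff_left inner_diff_right inner_commute)
    moreover have "b * (norm (x + y))\<^sup>2 + b * (norm (x - y))\<^sup>2 = 4 * b"
      using xy by (simp add: power2_norm_eq_inner inner_add_left inner_add_right inner_diff_left
          inner_diff_right algebra_simps) (simp flip: power2_norm_eq_inner)
    ultimately have "\<bar>x \<bullet> (D *v y)\<bar> \<le> b" using b[of "x + y"] b[of "x - y"] by linarith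
    moreover have "x \<bullet> (D *v y) = D $ i $ j"
      by (simp add: x_def y_def matrix_vector_mult_basis column_def inner_axis' )
    ultimately show "\<bar>(R - S) $ i $ j\<bar> \<le> sqrt (C * norm (R ** R - S ** S))"
      by (simp add: D_def b_def)
  qed (use C in simp)
qed

lemma psd_square_root_unique:
  fixes R S :: "real^'n^'n"
  assumes "psd R" "psd S" "R ** R = S ** S"
  shows "R = S"
proof -
  have "(R - S) $ i $ j = 0" for i j
    using psd_square_root_Hoelder[of i j] assms by (metis abs_le_zero_iff diff_self mult_zero_right norm_zero real_sqrt_zero)
  then show ?thesis by (simp add: vec_eq_iff)
qed

lemma
  assumes "psd M"
  shows psd_msqrt: "psd (msqrt M)" and msqrt_square: "msqrt M ** msqrt M = M"
proof -
  have "\<exists>!R. psd R \<and> R ** R = M"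
    using psd_square_root_exists[OF assms] psd_square_root_unique by metis
  from theI'[OF this] show "psd (msqrt M)" "msqrt M ** msqrt M = M"
    by (simp_all add: msqrt_def)
qed

lemma continuous_on_msqrt:
  fixes M :: "'a::topological_space \<Rightarrow> real^'n^'n"
  assumes M: "continuous_on S M" and psd: "\<And>s. s \<in> S \<Longrightarrow> psd (M s)"
  shows "continuous_on S (\<lambda>s. msqrt (M s))"
proof -
  have "continuous_on S (\<lambda>s. msqrt (M s) $ i $ j)" for i j
    unfolding continuous_on_def
  proof
    fix s assume s: "s \<in> S"
    obtain C where C: "C \<ge> 0" "\<And>R S :: real^'n^'n. psd R \<Longrightarrow> psd S \<Longrightarrow>
        \<bar>(R - S) $ i $ j\<bar> \<le> sqrt (C * norm (R ** R - S ** S))"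
      using psd_square_root_Hoelder[of i j] by metis
    have "((\<lambda>r. msqrt (M r) $ i $ j - msqrt (M s) $ i $ j) \<longlongrightarrow> 0) (at s within S)"
    proof (rule Lim_null_comparison)
      show "\<forall>\<^sub>F r in at s within S. norm (msqrt (M r) $ i $ j - msqrt (M s) $ i $ j) \<le> sqrt (C * norm (M r - M s))"
        unfolding eventually_at_topological
        using C(2)[OF psd_msqrt[OF psd] psd_msqrt[OF psd[OF s]]] s
        by (intro exI[of _ UNIV]) (auto simp: msqrt_square psd)
      have "((\<lambda>r. sqrt (C * norm (M r - M s))) \<longlongrightarrow> sqrt (C * norm (M s - M s))) (at s within S)"
        using M s by (intro tendsto_intros) (auto simp: continuous_on_def)
      then show "((\<lambda>r. sqrt (C * norm (M r - M s))) \<longlongrightarrow> 0) (at s within S)" by simp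
    qed
    then show "((\<lambda>r. msqrt (M r) $ i $ j) \<longlongrightarrow> msqrt (M s) $ i $ j) (at s within S)"
      by (simp add: LIM_zero_iff)
  qed
  then have "continuous_on S (\<lambda>s. \<chi> i j. msqrt (M s) $ i $ j)"
    by (intro continuous_on_vec_lambda)
  then show ?thesis by simp
qed

section \<open>Roots and inverses of positive definite matrices\<close>

text \<open>Keeps products in the form \<open>transpose A *v x\<close>, in which the adjoint rules
  for inner products are stated.\<close>

declare transpose_matrix_vector [simp del]

lemma pd_imp_psd: "pd M \<Longrightarrow> psd M"
  unfolding pd_def psd_def by (metis inner_zero_left less_imp_le order_refl)

lemma pd_invertible:
  fixes M :: "real^'n^'n"
  assumes "pd M" shows "invertible M"
proof -
  have "M *v x = 0 \<longrightarrow> x = 0" for x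
    using assms unfolding pd_def by (metis inner_zero_right less_irrefl)
  then show ?thesis using matrix_left_invertible_ker[of M] invertible_left_inverse by blast
qed

lemma msqrt_apply: "psd M \<Longrightarrow> msqrt M *v (msqrt M *v x) = M *v x"
  by (simp add: matrix_vector_mul_assoc msqrt_square)

lemma transpose_msqrt: "psd M \<Longrightarrow> transpose (msqrt M) = msqrt M"
  using psd_msqrt by (auto simp: psd_def)

context
  fixes M :: "real^'n^'n"
  assumes M: "pd M"
begin

lemma invertible_msqrt: "invertible (msqrt M)"
proof -
  obtain N where "M ** N = mat 1" using pd_invertible[OF M] by (auto simp: invertible_def)
  then have "msqrt M ** (msqrt M ** N) = mat 1"
    by (simp add: matrix_mul_assoc msqrt_square pd_imp_psd[OF M])
  then show ?thesis using invertible_right_inverse by blast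
qed

lemma msqrt_minvsqrt: "msqrt M *v (minvsqrt M *v x) = x" "minvsqrt M *v (msqrt M *v x) = x"
  using matrix_inv_apply[OF invertible_msqrt] by (simp_all add: minvsqrt_def)

lemma transpose_minvsqrt: "transpose (minvsqrt M) = minvsqrt M"
  by (simp add: minvsqrt_def transpose_matrix_inv invertible_msqrt transpose_msqrt pd_imp_psd[OF M])

lemma minvsqrt_apply: "minvsqrt M *v (minvsqrt M *v x) = matrix_inv M *v x"
proof -
  have "minvsqrt M *v (minvsqrt M *v x) = minvsqrt M *v (minvsqrt M *v (M *v (matrix_inv M *v x)))"
    by (simp add: matrix_inv_apply[OF pd_invertible[OF M]])
  also have "\<dots> = matrix_inv M *v x"
    by (simp add: msqrt_minvsqrt flip: msqrt_apply[OF pd_imp_psd[OF M]])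
  finally show ?thesis .
qed

lemma inner_matrix_inv_eq_norm: "x \<bullet> (matrix_inv M *v x) = (norm (minvsqrt M *v x))\<^sup>2"
  by (simp add: minvsqrt_apply[symmetric] power2_norm_eq_inner inner_symmetric[OF transpose_minvsqrt])

text \<open>Cauchy-Schwarz after inserting the root of \<open>M\<close> and its inverse between
  \<open>x\<close> and \<open>y\<close>. The right-hand side is the support function of the centred
  ellipsoid with shape matrix \<open>M\<close>.\<close>

lemma inner_le_dual_norms:
  assumes "y \<bullet> (matrix_inv M *v y) \<le> 1"
  shows "\<bar>x \<bullet> y\<bar> \<le> sqrt (x \<bullet> (M *v x))"
proof -
  have "x \<bullet> y = (msqrt M *v x) \<bullet> (minvsqrt M *v y)"
    by (simp add: inner_symmetric[OF transpose_msqrt] pd_imp_psd[OF M] msqrt_minvsqrt)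
  moreover have "(norm (minvsqrt M *v y))\<^sup>2 \<le> 1" using assms by (simp add: inner_matrix_inv_eq_norm)
  then have "norm (minvsqrt M *v y) \<le> 1" by (simp add: power_le_one_iff abs_square_le_1)
  then have "norm (msqrt M *v x) * norm (minvsqrt M *v y) \<le> norm (msqrt M *v x)"
    by (simp add: mult_left_le)
  moreover have "norm (msqrt M *v x) = sqrt (x \<bullet> (M *v x))"
    by (simp add: norm_eq_sqrt_inner inner_symmetric[OF transpose_msqrt] pd_imp_psd[OF M] msqrt_apply)
  ultimately show ?thesis using Cauchy_Schwarz_ineq2[of "msqrt M *v x" "minvsqrt M *v y"] by linarith
qed

end

lemma continuous_on_minvsqrt:
  fixes M :: "'a::topological_space \<Rightarrow> real^'n^'n"
  assumes "continuous_on S M" and "\<And>s. s \<in> S \<Longrightarrow> pd (M s)"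
  shows "continuous_on S (\<lambda>s. minvsqrt (M s))"
  unfolding minvsqrt_def using assms
  by (intro continuous_on_matrix_inv continuous_on_msqrt invertible_msqrt pd_imp_psd)

section \<open>Measurability of the minimal-energy control\<close>

text \<open>The minimal-energy control \<open>P B\<^sup>T \<mu>\<close> is the pointwise limit of its continuous Tikhonov
  regularisations, in which the possibly singular \<open>B P B\<^sup>T\<close> is replaced by \<open>B P B\<^sup>T + \<epsilon>\<close>.\<close>
lemma minimal_energy_control_measurable:
  fixes B :: "real \<Rightarrow> real^'m^'n" and P :: "real^'m^'m" and \<mu> g :: "real \<Rightarrow> real^'n"
  assumes P: "psd P" and B: "continuous_on {a..b} B" and g: "continuous_on {a..b} g"
    and \<mu>: "\<And>s. s \<in> {a..b} \<Longrightarrow> B s *v (P *v (transpose (B s) *v \<mu> s)) = g s"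
  shows "(\<lambda>s. P *v (transpose (B s) *v \<mu> s)) \<in> borel_measurable (lebesgue_on {a..b})"
proof -
  define \<epsilon> where "\<epsilon> k = inverse (real (Suc k))" for k
  have eps: "\<epsilon> k > 0" for k by (simp add: \<epsilon>_def)
  define N where "N s = B s ** P ** transpose (B s)" for s
  define R where "R = msqrt P"
  have Rsym: "transpose R = R" and RR: "R *v (R *v x) = P *v x" for x
    using P by (auto simp: R_def transpose_msqrt msqrt_apply)
  have N: "x \<bullet> (N s *v x) = (norm (R *v (transpose (B s) *v x)))\<^sup>2" for s x
  proof -
    have "x \<bullet> (N s *v x) = (transpose (B s) *v x) \<bullet> (P *v (transpose (B s) *v x))"
      using inner_transpose[of "transpose (B s)" x "P *v (transpose (B s) *v x)"]
      by (simp add: N_def flip: matrix_vector_mul_assoc)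
    then show ?thesis by (simp add: power2_norm_eq_inner inner_symmetric[OF Rsym] RR)
  qed
  define M where "M k s = N s + \<epsilon> k *\<^sub>R mat 1" for k s
  have M: "M k s *v x = N s *v x + \<epsilon> k *\<^sub>R x" for k s x
    by (simp add: M_def matrix_vector_mult_add_rdistrib flip: scaleR_matrix_vector_assoc)
  have inv: "invertible (M k s)" for k s
  proof -
    have "x = 0" if "M k s *v x = 0" for x
    proof -
      have "0 = x \<bullet> (M k s *v x)" using that by simp
      also have "\<dots> = (norm (R *v (transpose (B s) *v x)))\<^sup>2 + \<epsilon> k * (x \<bullet> x)"
        by (simp add: M inner_add_right N)
      finally have "\<epsilon> k * (x \<bullet> x) \<le> 0" by (metis add_le_same_cancel1 add.commute zero_le_power2)
      then have "x \<bullet> x \<le> 0" using eps[of k] by (simp add: mult_le_0_iff)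
      then show ?thesis by (metis inner_gt_zero_iff not_less)
    qed
    then show ?thesis using matrix_left_invertible_ker[of "M k s"] invertible_left_inverse by blast
  qed
  define m where "m k s = matrix_inv (M k s) *v g s" for k s
  define v where "v k s = P *v (transpose (B s) *v m k s)" for k s
  have "continuous_on {a..b} (v k)" for k
    unfolding v_def m_def using inv unfolding M_def N_def
    by (intro continuous_intros continuous_on_matrix_inv B g) auto
  then have meas: "v k \<in> borel_measurable (lebesgue_on {a..b})" for k
    by (intro continuous_imp_measurable_on_sets_lebesgue) auto
  have "(\<lambda>k. v k s) \<longlonglongrightarrow> P *v (transpose (B s) *v \<mu> s)" if s: "s \<in> {a..b}" for s
  proof -
    define d where "d k = m k s - \<mu> s" for k
    \<comment> \<open>On the kernel of \<open>N s\<close> the multiplier is not determined, so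
      \<open>m k s\<close> need not approach \<open>\<mu> s\<close>. The error is estimated only
      after applying the root of \<open>P\<close> and \<open>transpose (B s)\<close>, which is all
      that enters the control.\<close>
    have bound: "norm (R *v (transpose (B s) *v d k)) \<le> sqrt (\<epsilon> k * (\<mu> s \<bullet> \<mu> s))" for k
    proof -
      have "N s *v \<mu> s = g s"
        using \<mu>[OF s] by (simp add: N_def flip: matrix_vector_mul_assoc)
      then have "M k s *v d k = - \<epsilon> k *\<^sub>R \<mu> s"
        using matrix_inv_apply(1)[OF inv, of k s "g s"] M[of k s "\<mu> s"]
        by (simp add: d_def m_def matrix_vector_mult_diff_distrib)
      then have "d k \<bullet> (N s *v d k) + \<epsilon> k * (d k \<bullet> d k) = - \<epsilon> k * (\<mu> s \<bullet> d k)"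
        by (metis M inner_add_right inner_commute inner_scaleR_right)
      \<comment> \<open>Up to a factor 2 this says \<open>- (\<mu> s \<bullet> d k) \<le> d k
        \<bullet> d k + \<mu> s \<bullet> \<mu> s\<close>; the term in
        \<open>d k \<bullet> d k\<close> then cancels against the regularisation.\<close>
      moreover have "0 \<le> \<epsilon> k * ((d k + \<mu> s) \<bullet> (d k + \<mu> s) + d k \<bullet> d k + \<mu> s \<bullet> \<mu> s)"
        using eps[of k] by (intro mult_nonneg_nonneg add_nonneg_nonneg) auto
      then have "0 \<le> 2 * (\<epsilon> k * (d k \<bullet> d k)) + 2 * (\<epsilon> k * (\<mu> s \<bullet> d k)) + 2 * (\<epsilon> k * (\<mu> s \<bullet> \<mu> s))"
        by (simp add: inner_add_left inner_add_right inner_commute algebra_simps)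
      ultimately have "(norm (R *v (transpose (B s) *v d k)))\<^sup>2 \<le> \<epsilon> k * (\<mu> s \<bullet> \<mu> s)"
        unfolding N by simp
      then show ?thesis by (rule real_le_rsqrt)
    qed
    have "\<epsilon> \<longlonglongrightarrow> 0"
      unfolding \<epsilon>_def by (rule LIMSEQ_inverse_real_of_nat)
    then have "(\<lambda>k. sqrt (\<epsilon> k * (\<mu> s \<bullet> \<mu> s))) \<longlonglongrightarrow> sqrt (0 * (\<mu> s \<bullet> \<mu> s))"
      by (intro tendsto_intros)
    then have "(\<lambda>k. R *v (transpose (B s) *v d k)) \<longlonglongrightarrow> 0"
      by (intro Lim_null_comparison[OF eventuallyI[of _ sequentially, OF bound]]) simp
    then have "(\<lambda>k. R *v (R *v (transpose (B s) *v d k))) \<longlonglongrightarrow> R *v 0"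
      by (intro bounded_bilinear.tendsto[OF bounded_bilinear_matrix_vector_mult] tendsto_const)
    then have "(\<lambda>k. v k s - P *v (transpose (B s) *v \<mu> s)) \<longlonglongrightarrow> 0"
      by (simp add: RR d_def v_def matrix_vector_mult_diff_distrib)
    then show ?thesis by (simp add: LIM_zero_iff)
  qed
  then show ?thesis by (intro borel_measurable_LIMSEQ_metric[where f=v, OF meas]) auto
qed

section \<open>Linear differential equations\<close>

text \<open>Picard's operator on \<open>[t,T]\<close> is a contraction for the norm weighted by
  \<open>exp (- 2 L (s - t))\<close>; the fixed point \<open>g\<close> below is the solution multiplied by this weight.\<close>
lemma linear_ode_solution_exists:
  fixes F :: "real \<Rightarrow> real^'n^'n"
  assumes tT: "t \<le> T" and F: "continuous_on {t..T} F"
  obtains y where "y t = y0"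
    "\<And>s. s \<in> {t..T} \<Longrightarrow> (y has_vector_derivative F s *v y s) (at s within {t..T})"
proof -
  obtain K where K: "K > 0" "\<And>(A :: real^'n^'n) (x :: real^'n). norm (A *v x) \<le> norm A * norm x * K"
    using bounded_bilinear.pos_bounded[OF bounded_bilinear_matrix_vector_mult] by blast
  have "bounded (F ` {t..T})"
    by (intro compact_imp_bounded compact_continuous_image F) auto
  then obtain b where b: "b > 0" "\<And>s. s \<in> {t..T} \<Longrightarrow> norm (F s) \<le> b"
    unfolding bounded_pos by blast
  define L where "L = b * K"
  have L: "L > 0" using K b by (simp add: L_def)
  have FL: "norm (F s *v x) \<le> L * norm x" if "s \<in> {t..T}" for s x
  proof -
    have "norm (F s *v x) \<le> norm (F s) * norm x * K" by (rule K(2))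
    also have "\<dots> \<le> b * norm x * K"
      using b(2)[OF that] K(1) by (intro mult_right_mono) auto
    finally show ?thesis by (simp add: L_def mult_ac)
  qed
  define w where "w s = exp (2 * L * (s - t))" for s
  have w: "w s > 0" "inverse (w s) * w s = 1" for s by (simp_all add: w_def)
  have w_cont: "continuous_on X w" for X unfolding w_def by (intro continuous_intros)
  define \<phi> where "\<phi> g s = inverse (w s) *\<^sub>R (y0 + integral {t..s} (\<lambda>\<tau>. w \<tau> *\<^sub>R (F \<tau> *v apply_bcontfun g \<tau>)))"
    for g :: "real \<Rightarrow>\<^sub>C (real^'n)" and s
  have integrand_cont: "continuous_on {t..T} (\<lambda>\<tau>. w \<tau> *\<^sub>R (F \<tau> *v apply_bcontfun g \<tau>))"
    for g :: "real \<Rightarrow>\<^sub>C (real^'n)"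
    by (intro continuous_intros F w_cont continuous_on_apply_bcontfun)
  have "continuous_on (cbox t T) (\<phi> g)" for g
    unfolding \<phi>_def using w(1) integrand_cont[of g]
    by (intro continuous_intros w_cont) (auto simp: less_imp_neq[symmetric] intro!: indefinite_integral_continuous_1 integrable_continuous_real)
  \<comment> \<open>Bounded continuous functions live on the whole line, so Picard's image is
    extended by its end values.\<close>
  then have "\<exists>h. \<forall>s. apply_bcontfun h s = \<phi> g (clamp t T s)" for g
    by (metis continuous_on_cbox_bcontfunE)
  then obtain \<Phi> where \<Phi>: "\<And>g s. apply_bcontfun (\<Phi> g) s = \<phi> g (clamp t T s)" by metis
  have clamp: "clamp t T s \<in> {t..T}" for s using clamp_in_interval[of t T s] tT by simp
  have "dist (\<Phi> g) (\<Phi> h) \<le> (1 / 2) * dist g h" for g h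
  proof (rule dist_bound)
    fix s
    define c where "c = clamp t T s"
    have c: "c \<in> {t..T}" using clamp by (simp add: c_def)
    have int: "(\<lambda>\<tau>. w \<tau> *\<^sub>R (F \<tau> *v apply_bcontfun k \<tau>)) integrable_on {t..c}" for k
      using c by (intro integrable_continuous_real continuous_on_subset[OF integrand_cont]) auto
    \<comment> \<open>The rate \<open>2 * L\<close> of the weight makes \<open>L\<close> times the
      integral of \<open>w\<close> at most \<open>w c / 2\<close>, the source of the contraction
      constant 1/2.\<close>
    have W: "((\<lambda>\<tau>. L * dist g h * w \<tau>) has_integral (dist g h / 2 * w c - dist g h / 2 * w t)) {t..c}"
    proof (rule fundamental_theorem_of_calculus)
      show "((\<lambda>\<tau>. dist g h / 2 * w \<tau>) has_vector_derivative L * dist g h * w x) (at x within {t..c})" for x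
        unfolding w_def has_real_derivative_iff_has_vector_derivative[symmetric]
        by (auto intro!: derivative_eq_intros)
    qed (use c in simp)
    have "norm (integral {t..c} (\<lambda>\<tau>. w \<tau> *\<^sub>R (F \<tau> *v g \<tau>)) - integral {t..c} (\<lambda>\<tau>. w \<tau> *\<^sub>R (F \<tau> *v h \<tau>)))
        = norm (integral {t..c} (\<lambda>\<tau>. w \<tau> *\<^sub>R (F \<tau> *v g \<tau>) - w \<tau> *\<^sub>R (F \<tau> *v h \<tau>)))"
      by (simp add: integral_diff int)
    also have "\<dots> \<le> integral {t..c} (\<lambda>\<tau>. L * dist g h * w \<tau>)"
    proof (rule integral_norm_bound_integral)
      fix \<tau> assume "\<tau> \<in> {t..c}"
      then have \<tau>: "\<tau> \<in> {t..T}" using c by auto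
      have "norm (F \<tau> *v (g \<tau> - h \<tau>)) \<le> L * dist (g \<tau>) (h \<tau>)"
        using FL[OF \<tau>] by (simp add: dist_norm)
      also have "\<dots> \<le> L * dist g h" using L by (intro mult_left_mono dist_bounded) auto
      finally have Fgh: "norm (F \<tau> *v (g \<tau> - h \<tau>)) \<le> L * dist g h" .
      have "w \<tau> *\<^sub>R (F \<tau> *v g \<tau>) - w \<tau> *\<^sub>R (F \<tau> *v h \<tau>) = w \<tau> *\<^sub>R (F \<tau> *v (g \<tau> - h \<tau>))"
        by (simp add: matrix_vector_mult_diff_distrib scaleR_diff_right)
      also have "norm \<dots> = w \<tau> * norm (F \<tau> *v (g \<tau> - h \<tau>))" using w(1)[of \<tau>] by simp
      also have "w \<tau> * norm (F \<tau> *v (g \<tau> - h \<tau>)) \<le> w \<tau> * (L * dist g h)"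
        using w(1)[of \<tau>] Fgh by (intro mult_left_mono) auto
      finally show "norm (w \<tau> *\<^sub>R (F \<tau> *v g \<tau>) - w \<tau> *\<^sub>R (F \<tau> *v h \<tau>)) \<le> L * dist g h * w \<tau>"
        by (simp add: mult_ac)
    qed (use int W in \<open>auto intro: integrable_diff\<close>)
    also have "\<dots> = dist g h / 2 * w c - dist g h / 2 * w t" by (rule integral_unique[OF W])
    also have "\<dots> \<le> dist g h / 2 * w c" using w(1)[of t] by simp
    finally have *: "norm (integral {t..c} (\<lambda>\<tau>. w \<tau> *\<^sub>R (F \<tau> *v g \<tau>)) - integral {t..c} (\<lambda>\<tau>. w \<tau> *\<^sub>R (F \<tau> *v h \<tau>)))
      \<le> dist g h / 2 * w c" .
    have "dist (\<phi> g c) (\<phi> h c) = inverse (w c) * norm (integral {t..c} (\<lambda>\<tau>. w \<tau> *\<^sub>R (F \<tau> *v g \<tau>)) - integral {t..c} (\<lambda>\<tau>. w \<tau> *\<^sub>R (F \<tau> *v h \<tau>)))"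
      using w(1)[of c] by (simp add: \<phi>_def dist_norm flip: scaleR_diff_right)
    also have "\<dots> \<le> inverse (w c) * (dist g h / 2 * w c)"
      using * w(1)[of c] by (intro mult_left_mono) auto
    also have "\<dots> = (1 / 2) * dist g h" using w(2)[of c] by (simp add: mult_ac)
    finally show "dist (\<Phi> g s) (\<Phi> h s) \<le> (1 / 2) * dist g h" by (simp add: \<Phi> c_def)
  qed
  then obtain g where g: "\<Phi> g = g"
    using banach_fix_type[of "1/2" \<Phi>] by auto
  define y where "y s = w s *\<^sub>R apply_bcontfun g s" for s
  have y: "y s = y0 + integral {t..s} (\<lambda>\<tau>. F \<tau> *v y \<tau>)" if "s \<in> {t..T}" for s
  proof -
    have "clamp t T s = s" using that by simp
    then have "apply_bcontfun g s = \<phi> g s" using \<Phi>[of g s] g by simp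
    then show ?thesis
      using w(1)[of s] by (simp add: y_def \<phi>_def matrix_vector_mult_scaleR)
  qed
  show thesis
  proof (rule that)
    show "y t = y0" using y[of t] tT by simp
    fix s assume s: "s \<in> {t..T}"
    have "((\<lambda>u. integral {t..u} (\<lambda>\<tau>. F \<tau> *v y \<tau>)) has_vector_derivative F s *v y s) (at s within {t..T})"
      using integrand_cont[of g] s
      by (intro integral_has_vector_derivative) (simp_all add: y_def matrix_vector_mult_scaleR)
    then have "((\<lambda>u. y0 + integral {t..u} (\<lambda>\<tau>. F \<tau> *v y \<tau>)) has_vector_derivative F s *v y s) (at s within {t..T})"
      using has_vector_derivative_add[OF has_vector_derivative_const] by force
    then show "(y has_vector_derivative F s *v y s) (at s within {t..T})"
      by (intro has_vector_derivative_transform[OF s y])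
  qed
qed

section \<open>The inverse quadratic form along curves\<close>

text \<open>An exact increment formula resting on the resolvent-type identity for the difference of
  two inverses. Only increments of \<open>y\<close> and \<open>Q\<close> occur, so both absolute
  continuity and the derivative follow from it without differentiating an inverse.\<close>

lemma inverse_quadratic_form_diff:
  fixes Q R :: "real^'n^'n"
  assumes Q: "pd Q" and R: "pd R"
  shows "y \<bullet> (matrix_inv R *v y) - x \<bullet> (matrix_inv Q *v x) =
    (y - x) \<bullet> (matrix_inv Q *v x + matrix_inv R *v y)
      - (matrix_inv Q *v x) \<bullet> ((R - Q) *v (matrix_inv R *v y))"
proof -
  define a where "a = matrix_inv Q *v x"
  define b where "b = matrix_inv R *v y"
  have ab: "x = Q *v a" "y = R *v b"
    using matrix_inv_apply[OF pd_invertible[OF Q]] matrix_inv_apply[OF pd_invertible[OF R]]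
    by (simp_all add: a_def b_def)
  have "(R *v b) \<bullet> a = a \<bullet> (R *v b)" "(Q *v a) \<bullet> b = a \<bullet> (Q *v b)"
    using inner_symmetric[of Q a b] Q by (simp_all add: inner_commute pd_def)
  then show ?thesis
    unfolding a_def[symmetric] b_def[symmetric] unfolding ab
    by (simp add: inner_diff_left inner_add_right inner_diff_right matrix_vector_mult_diff_rdistrib)
qed

lemma abs_continuous_on_inverse_quadratic_form:
  fixes Q :: "real \<Rightarrow> real^'n^'n"
  assumes Q: "abs_continuous_on a b Q" and y: "abs_continuous_on a b y"
    and pd: "\<And>s. s \<in> {a..b} \<Longrightarrow> pd (Q s)"
  shows "abs_continuous_on a b (\<lambda>s. y s \<bullet> (matrix_inv (Q s) *v y s))"
proof -
  define z where "z s = matrix_inv (Q s) *v y s" for s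
  obtain K where K: "K > 0" "\<And>(A :: real^'n^'n) (x :: real^'n). norm (A *v x) \<le> norm A * norm x * K"
    using bounded_bilinear.pos_bounded[OF bounded_bilinear_matrix_vector_mult] by blast
  have "continuous_on {a..b} z"
    unfolding z_def using pd
    by (intro continuous_intros continuous_on_matrix_inv pd_invertible
        abs_continuous_on_imp_continuous_on Q y)
  then have "bounded (z ` {a..b})"
    by (intro compact_imp_bounded compact_continuous_image) auto
  then obtain c where c: "c > 0" "\<And>s. s \<in> {a..b} \<Longrightarrow> norm (z s) \<le> c"
    unfolding bounded_pos by blast
  \<comment> \<open>\<open>2 * c\<close> bounds the sum of the two values of \<open>z\<close>, and
    \<open>c * c * K\<close> the coefficient of the increment of \<open>Q\<close>.\<close>
  define C where "C = max (2 * c) (c * c * K)"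
  show ?thesis
  proof (rule abs_continuous_on_dominated[OF y Q, where C=C])
    fix u v assume uv: "a \<le> u" "u \<le> v" "v \<le> b"
    have zu: "norm (z u) \<le> c" "norm (z v) \<le> c" using c(2) uv by auto
    have "\<bar>(y v - y u) \<bullet> (z u + z v)\<bar> \<le> norm (y v - y u) * (2 * c)"
      using Cauchy_Schwarz_ineq2[of "y v - y u" "z u + z v"] norm_triangle_ineq[of "z u" "z v"] zu
      by (intro order_trans[OF Cauchy_Schwarz_ineq2] mult_left_mono) auto
    also have "\<dots> \<le> C * norm (y v - y u)"
      unfolding C_def by (subst mult.commute, intro mult_right_mono) auto
    finally have 1: "\<bar>(y v - y u) \<bullet> (z u + z v)\<bar> \<le> C * norm (y v - y u)" .
    have "\<bar>z u \<bullet> ((Q v - Q u) *v z v)\<bar> \<le> norm (z u) * norm ((Q v - Q u) *v z v)"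
      by (rule Cauchy_Schwarz_ineq2)
    also have "\<dots> \<le> c * (norm (Q v - Q u) * c * K)"
      using zu c K(1)
      by (intro mult_mono order_trans[OF K(2)] mult_right_mono mult_left_mono) auto
    also have "\<dots> = c * c * K * norm (Q v - Q u)" by simp
    also have "\<dots> \<le> C * norm (Q v - Q u)" unfolding C_def by (intro mult_right_mono) auto
    finally have 2: "\<bar>z u \<bullet> ((Q v - Q u) *v z v)\<bar> \<le> C * norm (Q v - Q u)" .
    show "norm (y v \<bullet> (matrix_inv (Q v) *v y v) - y u \<bullet> (matrix_inv (Q u) *v y u))
        \<le> C * norm (y v - y u) + C * norm (Q v - Q u)"
      using inverse_quadratic_form_diff[of "Q u" "Q v" "y v" "y u"] pd uv 1 2
      by (simp add: z_def)
  qed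
qed

text \<open>The increment formula divided by \<open>r - s\<close>; in the limit the inverse of
  \<open>Q\<close> need only be continuous.\<close>

lemma has_vector_derivative_inverse_quadratic_form:
  fixes Q :: "real \<Rightarrow> real^'n^'n"
  assumes Q: "continuous_on {a..b} Q" and pd: "\<And>s. s \<in> {a..b} \<Longrightarrow> pd (Q s)"
    and s: "s \<in> {a<..<b}"
    and Q': "(Q has_vector_derivative Q') (at s)" and y': "(y has_vector_derivative y') (at s)"
  defines "z \<equiv> matrix_inv (Q s) *v y s"
  shows "((\<lambda>s. y s \<bullet> (matrix_inv (Q s) *v y s)) has_vector_derivative
            2 * (y' \<bullet> z) - z \<bullet> (Q' *v z)) (at s)"
proof -
  let ?z = "\<lambda>r. matrix_inv (Q r) *v y r"
  let ?V = "\<lambda>r. y r \<bullet> ?z r"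
  have "continuous_on {a<..<b} (\<lambda>r. matrix_inv (Q r))"
    using pd by (intro continuous_on_matrix_inv pd_invertible continuous_on_subset[OF Q]) auto
  then have "isCont (\<lambda>r. matrix_inv (Q r)) s"
    using s by (simp add: continuous_on_eq_continuous_at)
  moreover have "isCont y s" using y' by (rule has_vector_derivative_continuous)
  ultimately have z: "(?z \<longlongrightarrow> z) (at s)"
    unfolding z_def isCont_def
    by (intro bounded_bilinear.tendsto[OF bounded_bilinear_matrix_vector_mult])
  have quot: "((\<lambda>r. (1 / (r - s)) *\<^sub>R (f r - f s)) \<longlongrightarrow> f') (at s)"
    if "(f has_vector_derivative f') (at s)" for f :: "real \<Rightarrow> 'c::real_normed_vector" and f'
  proof -
    have "((\<lambda>r. norm (f r - f s - (r - s) *\<^sub>R f') / norm (r - s)) \<longlongrightarrow> 0) (at s)"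
      using that unfolding has_vector_derivative_def has_derivative_iff_norm by simp
    moreover have "\<forall>\<^sub>F r in at s. norm (f r - f s - (r - s) *\<^sub>R f') / norm (r - s) =
        norm ((1 / (r - s)) *\<^sub>R (f r - f s) - f')"
      using eventually_neq_at_within[of s]
    proof eventually_elim
      case (elim r)
      then have "(1 / (r - s)) *\<^sub>R (f r - f s) - f' = (1 / (r - s)) *\<^sub>R (f r - f s - (r - s) *\<^sub>R f')"
        by (simp add: scaleR_diff_right)
      then show ?case by (simp add: divide_inverse)
    qed
    ultimately have "((\<lambda>r. norm ((1 / (r - s)) *\<^sub>R (f r - f s) - f')) \<longlongrightarrow> 0) (at s)"
      by (rule Lim_transform_eventually)
    then show ?thesis by (simp only: tendsto_norm_zero_iff LIM_zero_iff)
  qed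
  have "((\<lambda>r. ((1 / (r - s)) *\<^sub>R (y r - y s)) \<bullet> (z + ?z r) - z \<bullet> (((1 / (r - s)) *\<^sub>R (Q r - Q s)) *v ?z r))
     \<longlongrightarrow> y' \<bullet> (z + z) - z \<bullet> (Q' *v z)) (at s)"
    by (intro tendsto_intros bounded_bilinear.tendsto[OF bounded_bilinear_matrix_vector_mult] z quot Q' y')
  moreover have "\<forall>\<^sub>F r in at s. ((1 / (r - s)) *\<^sub>R (y r - y s)) \<bullet> (z + ?z r) - z \<bullet> (((1 / (r - s)) *\<^sub>R (Q r - Q s)) *v ?z r)
      = (?V r - ?V s) / (r - s)"
  proof -
    have "\<forall>\<^sub>F r in at s. r \<in> {a<..<b}" using s by (intro eventually_at_in_open') auto
    then show ?thesis
    proof eventually_elim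
      case (elim r)
      have eq: "?V r - ?V s = (y r - y s) \<bullet> (z + ?z r) - z \<bullet> ((Q r - Q s) *v ?z r)"
        unfolding z_def using pd s elim by (intro inverse_quadratic_form_diff) auto
      show ?case unfolding eq
        by (simp add: diff_divide_distrib flip: scaleR_matrix_vector_assoc)
    qed
  qed
  ultimately have "((\<lambda>r. (?V r - ?V s) / (r - s)) \<longlongrightarrow> y' \<bullet> (z + z) - z \<bullet> (Q' *v z)) (at s)"
    by (rule Lim_transform_eventually)
  moreover have "y' \<bullet> (z + z) = 2 * (y' \<bullet> z)" by (subst inner_add_right) simp
  ultimately show ?thesis
    by (simp only: has_real_derivative_iff_has_vector_derivative[symmetric] has_field_derivative_iff)
qed

section \<open>A single tube of ellipsoids and the function V\<close>

locale ellipsoidal_tube =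
  fixes T :: real and A :: "real \<Rightarrow> real^'n^'n" and B :: "real \<Rightarrow> real^'m^'n"
    and p :: "real^'m" and P :: "real^'m^'m" and xe :: "real^'n" and Xe :: "real^'n^'n"
    and S :: "real \<Rightarrow> real^'n^'n" and q :: "real \<Rightarrow> real^'n" and Q :: "real \<Rightarrow> real^'n^'n"
  assumes A_cont: "continuous_on {0..T} A" and B_cont: "continuous_on {0..T} B"
    and P_pd: "pd P" and S_cont: "continuous_on {0..T} S"
    and S_orth: "\<And>t. t \<in> {0..T} \<Longrightarrow> orthogonal_matrix (S t)"
    and sol: "fvp_solution A B p P xe Xe S T q Q"
    and Q_pd: "\<And>t. t \<in> {0..T} \<Longrightarrow> pd (Q t)"
begin

abbreviation "H s \<equiv> msqrt (Q s)"
abbreviation "Hinv s \<equiv> minvsqrt (Q s)"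
abbreviation "K s \<equiv> msqrt (Qstar B P s (Q s))"

definition V :: "(real \<Rightarrow> real^'n) \<Rightarrow> real \<Rightarrow> real" where
  "V y s = y s \<bullet> (matrix_inv (Q s) *v y s)"

lemma Q_cont: "continuous_on {0..T} Q"
  using sol by (auto simp: fvp_solution_def intro: abs_continuous_on_imp_continuous_on)

lemma V_eq_norm: "s \<in> {0..T} \<Longrightarrow> V y s = (norm (Hinv s *v y s))\<^sup>2"
  unfolding V_def by (rule inner_matrix_inv_eq_norm[OF Q_pd])

lemma Qstar_quadratic_form:
  assumes "s \<in> {0..T}"
  shows "x \<bullet> (Qstar B P s (Q s) *v x) =
    (transpose (B s) *v (Hinv s *v x)) \<bullet> (P *v (transpose (B s) *v (Hinv s *v x)))"
  by (simp add: Qstar_def inner_transpose' inner_symmetric[OF transpose_minvsqrt[OF Q_pd[OF assms]]]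
      flip: matrix_vector_mul_assoc)

lemma Qstar_psd:
  assumes "s \<in> {0..T}"
  shows "psd (Qstar B P s (Q s))"
  unfolding psd_def
proof
  have "transpose P = P" using P_pd by (simp add: pd_def)
  then show "transpose (Qstar B P s (Q s)) = Qstar B P s (Q s)"
    by (simp add: Qstar_def matrix_transpose_mul transpose_minvsqrt[OF Q_pd[OF assms]] matrix_mul_assoc)
  show "\<forall>x. 0 \<le> x \<bullet> (Qstar B P s (Q s) *v x)"
    using pd_imp_psd[OF P_pd] by (simp add: Qstar_quadratic_form[OF assms] psd_def)
qed

lemma K_sym: "s \<in> {0..T} \<Longrightarrow> (K s *v x) \<bullet> y = x \<bullet> (K s *v y)"
  by (rule inner_symmetric[OF transpose_msqrt[OF Qstar_psd]])

text \<open>The norm of \<open>K s *v x\<close> is the support function of the centred input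
  ellipsoid in the direction \<open>transpose (B s) *v (Hinv s *v x)\<close>. It measures the energy
  of the feedback in (a) and the largest influence of any control in (b).\<close>

lemma norm_K:
  assumes "s \<in> {0..T}"
  shows "(norm (K s *v x))\<^sup>2 =
    (transpose (B s) *v (Hinv s *v x)) \<bullet> (P *v (transpose (B s) *v (Hinv s *v x)))"
  by (simp add: power2_norm_eq_inner K_sym[OF assms] msqrt_apply[OF Qstar_psd[OF assms]]
      Qstar_quadratic_form[OF assms])

lemma norm_S: "s \<in> {0..T} \<Longrightarrow> norm (S s *v x) = norm x"
  using orthogonal_transformation_norm orthogonal_transformation_matrix S_orth by fastforce

lemma V_abs_continuous:
  assumes "0 \<le> t" "abs_continuous_on t T y"
  shows "abs_continuous_on t T (V y)"
  unfolding V_def using assms sol Q_pd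
  by (intro abs_continuous_on_inverse_quadratic_form)
    (auto simp: fvp_solution_def intro: abs_continuous_on_subinterval)

text \<open>In the direction \<open>z = Q\<^sup>-\<^sup>1 y\<close> the terms in \<open>A\<close> cancel, leaving the forcing term and the
  contribution of \<open>Rlow\<close>.\<close>
lemma V_has_derivative:
  assumes s: "s \<in> {0<..<T}"
    and Q': "(Q has_vector_derivative A s ** Q s + Q s ** transpose (A s) - Rlow B P S s (Q s)) (at s)"
    and y': "(y has_vector_derivative A s *v y s + f) (at s)"
  shows "(V y has_vector_derivative
     2 * (f \<bullet> (matrix_inv (Q s) *v y s)) + 2 * ((K s *v (Hinv s *v y s)) \<bullet> (S s *v (Hinv s *v y s)))) (at s)"
proof -
  define z where "z = matrix_inv (Q s) *v y s"
  define w where "w = Hinv s *v y s"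
  have s0: "s \<in> {0..T}" using s by auto
  note pd = Q_pd[OF s0]
  have Qz: "Q s *v z = y s" by (simp add: z_def matrix_inv_apply pd_invertible pd)
  have Hz: "H s *v z = w" by (simp add: z_def w_def msqrt_minvsqrt[OF pd] flip: minvsqrt_apply[OF pd])
  have Qsym: "x \<bullet> (Q s *v v) = (Q s *v x) \<bullet> v" for x v
    using pd by (intro inner_symmetric[symmetric]) (simp add: pd_def)
  have Hsym: "x \<bullet> (H s *v v) = (H s *v x) \<bullet> v" for x v
    by (intro inner_symmetric[symmetric] transpose_msqrt pd_imp_psd pd)
  have "z \<bullet> ((Q s ** transpose (A s)) *v z) = (A s *v y s) \<bullet> z"
    by (simp add: Qsym Qz inner_transpose flip: matrix_vector_mul_assoc)
  moreover have "z \<bullet> ((A s ** Q s) *v z) = (A s *v y s) \<bullet> z"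
    by (simp add: Qz inner_commute flip: matrix_vector_mul_assoc)
  moreover have "z \<bullet> (Rlow B P S s (Q s) *v z) = 2 * ((K s *v w) \<bullet> (S s *v w))"
  proof -
    have "z \<bullet> (Rlow B P S s (Q s) *v z) = w \<bullet> (K s *v (S s *v w) + transpose (S s) *v (K s *v w))"
      by (simp add: Rlow_def Hsym Hz matrix_vector_mult_add_rdistrib flip: matrix_vector_mul_assoc)
    also have "w \<bullet> (K s *v (S s *v w)) = (K s *v w) \<bullet> (S s *v w)" by (simp add: K_sym[OF s0])
    moreover have "w \<bullet> (transpose (S s) *v (K s *v w)) = (K s *v w) \<bullet> (S s *v w)"
      by (simp add: inner_transpose inner_commute flip: inner_transpose)
    ultimately show ?thesis by (simp add: inner_add_right)
  qed
  ultimately have "2 * ((A s *v y s + f) \<bullet> z)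
      - z \<bullet> ((A s ** Q s + Q s ** transpose (A s) - Rlow B P S s (Q s)) *v z)
      = 2 * (f \<bullet> z) + 2 * ((K s *v w) \<bullet> (S s *v w))"
    by (simp add: matrix_vector_mult_add_rdistrib matrix_vector_mult_diff_rdistrib inner_add_left
        inner_add_right inner_diff_right)
  then show ?thesis
    using has_vector_derivative_inverse_quadratic_form[OF Q_cont Q_pd s Q' y']
    by (simp add: V_def[abs_def] z_def w_def)
qed

text \<open>The forcing term is left arbitrary, so the formula covers both the feedback of (a) and
  the given control of (b).\<close>

lemma V_AE_derivative:
  assumes t: "0 \<le> t" and y': "AE s in lborel. s \<in> {t<..<T} \<longrightarrow> (y has_vector_derivative A s *v y s + f s) (at s)"
  shows "AE s in lborel. s \<in> {t<..<T} \<longrightarrow> (V y has_vector_derivative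
     2 * (f s \<bullet> (matrix_inv (Q s) *v y s)) + 2 * ((K s *v (Hinv s *v y s)) \<bullet> (S s *v (Hinv s *v y s)))) (at s)"
proof -
  have "AE s in lborel. s \<in> {0<..<T} \<longrightarrow>
     (Q has_vector_derivative A s ** Q s + Q s ** transpose (A s) - Rlow B P S s (Q s)) (at s)"
    using sol by (auto simp: fvp_solution_def elim: AE_mp)
  with y' show ?thesis
  proof eventually_elim
    case (elim s)
    show ?case
    proof
      assume "s \<in> {t<..<T}"
      then show "(V y has_vector_derivative 2 * (f s \<bullet> (matrix_inv (Q s) *v y s)) +
          2 * ((K s *v (Hinv s *v y s)) \<bullet> (S s *v (Hinv s *v y s)))) (at s)"
        using elim t by (intro V_has_derivative) auto
    qed
  qed
qed

lemma ellipsoid_iff_V: "x s \<in> ellipsoid (q s) (Q s) \<longleftrightarrow> V (\<lambda>s. x s - q s) s \<le> 1"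
  by (simp add: ellipsoid_def V_def)

text \<open>Decomposing \<open>S w = K \<gamma> + \<beta>\<close> with \<open>K \<beta> = 0\<close> gives \<open>K S w = K\<^sup>2 \<gamma>\<close> and \<open>\<bar>K \<gamma>\<bar> \<le> \<bar>w\<bar>\<close>.\<close>
lemma feedback_multiplier_exists:
  assumes s: "s \<in> {0..T}" and w: "norm w \<le> 1"
  obtains \<mu> where "B s *v (P *v (transpose (B s) *v \<mu>)) = - (H s *v (K s *v (S s *v w)))"
    "(transpose (B s) *v \<mu>) \<bullet> (P *v (transpose (B s) *v \<mu>)) \<le> 1"
proof -
  have sub: "span (range ((*v) (K s))) = range ((*v) (K s))"
    by (simp add: span_eq_iff linear_subspace_image[OF matrix_vector_mul_linear subspace_UNIV])
  obtain k \<beta> where k: "k \<in> range ((*v) (K s))" and \<beta>: "\<And>r. r \<in> range ((*v) (K s)) \<Longrightarrow> orthogonal \<beta> r"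
    and h: "S s *v w = k + \<beta>"
    using orthogonal_subspace_decomp_exists[of "range ((*v) (K s))" "S s *v w"] unfolding sub by metis
  obtain \<gamma> where \<gamma>: "k = K s *v \<gamma>" using k by blast
  \<comment> \<open>\<open>K s\<close> is symmetric, so the orthogonal complement of its range is
    its kernel.\<close>
  have "(K s *v \<beta>) \<bullet> (K s *v \<beta>) = \<beta> \<bullet> (K s *v (K s *v \<beta>))" by (rule K_sym[OF s])
  also have "\<dots> = 0" using \<beta> by (auto simp: orthogonal_def)
  finally have K\<beta>: "K s *v \<beta> = 0" by simp
  have "K s *v (S s *v w) = Qstar B P s (Q s) *v \<gamma>"
    by (simp add: h matrix_vector_right_distrib K\<beta> \<gamma> msqrt_apply[OF Qstar_psd[OF s]])
  \<comment> \<open>\<open>H s\<close> cancels the left factor of \<open>Qstar\<close>; the right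
    factor \<open>Hinv s\<close> is absorbed into the multiplier.\<close>
  then have 1: "H s *v (K s *v (S s *v w)) = B s *v (P *v (transpose (B s) *v (Hinv s *v \<gamma>)))"
    by (simp add: Qstar_def msqrt_minvsqrt[OF Q_pd[OF s]] flip: matrix_vector_mul_assoc)
  have "(norm k)\<^sup>2 \<le> (norm k)\<^sup>2 + (norm \<beta>)\<^sup>2" by simp
  also have "\<dots> = (norm (S s *v w))\<^sup>2"
    unfolding h using \<beta>[OF k] by (intro norm_add_Pythagorean[symmetric]) (simp add: orthogonal_commute)
  also have "\<dots> \<le> 1" using w by (simp add: norm_S[OF s] power_le_one)
  finally have "(norm k)\<^sup>2 \<le> 1" .
  then have 2: "(transpose (B s) *v (Hinv s *v \<gamma>)) \<bullet> (P *v (transpose (B s) *v (Hinv s *v \<gamma>))) \<le> 1"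
    by (simp add: \<gamma> norm_K[OF s])
  have neg: "M *v (- x) = - (M *v x)" for M :: "real^'a^'b" and x
    using matrix_vector_mult_diff_distrib[of M 0 x] by simp
  show thesis
    by (rule that[of "- (Hinv s *v \<gamma>)"]) (simp_all add: neg 1 2)
qed

section \<open>Inclusion of the tube in the reachable set\<close>

lemma ellipsoid_subset_reach_set:
  assumes t: "t \<in> {0..T}"
  shows "ellipsoid (q t) (Q t) \<subseteq> reach_set A B (ellipsoid p P) (ellipsoid xe Xe) T t"
proof
  fix x assume x: "x \<in> ellipsoid (q t) (Q t)"
  have tT: "t \<le> T" and sub: "{t..T} \<subseteq> {0..T}" using t by auto
  \<comment> \<open>The closed-loop matrix: the deviation equation with the feedback term written as
    a linear function of \<open>y\<close>.\<close>
  define F where "F s = A s - H s ** K s ** S s ** Hinv s" for s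
  have Hinv_cont: "continuous_on {0..T} Hinv"
    using Q_cont Q_pd by (rule continuous_on_minvsqrt)
  have K_cont: "continuous_on {0..T} K"
  proof (rule continuous_on_msqrt)
    show "continuous_on {0..T} (\<lambda>s. Qstar B P s (Q s))"
      unfolding Qstar_def by (intro continuous_intros B_cont Hinv_cont)
  qed (rule Qstar_psd)
  have H_cont: "continuous_on {0..T} H"
    using Q_cont Q_pd by (intro continuous_on_msqrt pd_imp_psd)
  have "continuous_on {0..T} F"
    unfolding F_def by (intro continuous_intros A_cont H_cont K_cont S_cont Hinv_cont)
  then have F_cont: "continuous_on {t..T} F" using sub by (rule continuous_on_subset)
  obtain y where y: "y t = x - q t"
    "\<And>s. s \<in> {t..T} \<Longrightarrow> (y has_vector_derivative F s *v y s) (at s within {t..T})"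
    using linear_ode_solution_exists[OF tT F_cont] by metis
  have y_cont: "continuous_on {t..T} y"
    unfolding continuous_on_eq_continuous_within
    using has_vector_derivative_continuous[OF y(2)] by blast
  define w where "w s = Hinv s *v y s" for s
  define f where "f s = - (H s *v (K s *v (S s *v w s)))" for s
  have Fy: "F s *v y s = A s *v y s + f s" for s
    by (simp add: F_def f_def w_def matrix_vector_mult_diff_rdistrib flip: matrix_vector_mul_assoc)
  have w_cont: "continuous_on {t..T} w"
    unfolding w_def by (intro continuous_intros y_cont continuous_on_subset[OF Hinv_cont sub])
  have "continuous_on {t..T} (\<lambda>s. H s *v (K s *v (S s *v w s)))"
    by (intro continuous_intros w_cont continuous_on_subset[OF H_cont sub]
        continuous_on_subset[OF K_cont sub] continuous_on_subset[OF S_cont sub])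
  then have f_cont: "continuous_on {t..T} f" unfolding f_def by (rule continuous_on_minus)
  have y_at: "(y has_vector_derivative A s *v y s + f s) (at s)" if "s \<in> {t<..<T}" for s
    using y(2)[of s] that unfolding Fy by (simp add: at_within_Icc_at)
  have y_ac: "abs_continuous_on t T y"
  proof -
    have "bounded ((\<lambda>s. F s *v y s) ` {t..T})"
      by (intro compact_imp_bounded compact_continuous_image continuous_intros F_cont y_cont) auto
    then obtain c where c: "\<And>s. s \<in> {t..T} \<Longrightarrow> norm (F s *v y s) \<le> c"
      unfolding bounded_iff by blast
    show ?thesis
    proof (rule abs_continuous_on_Lipschitz)
      fix u v assume uv: "t \<le> u" "u \<le> v" "v \<le> T"
      have "norm (y v - y u) \<le> c * norm (v - u)"
      proof (rule differentiable_bound)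
        show "(y has_derivative (\<lambda>h. h *\<^sub>R (F s *v y s))) (at s within {t..T})" if "s \<in> {t..T}" for s
          using y(2)[OF that] by (simp add: has_vector_derivative_def)
        show "onorm (\<lambda>h. h *\<^sub>R (F s *v y s)) \<le> c" if "s \<in> {t..T}" for s
        proof (rule onorm_le)
          show "norm (h *\<^sub>R (F s *v y s)) \<le> c * norm h" for h :: real
            using mult_right_mono[OF c[OF that] abs_ge_zero[of h]] by (simp add: mult.commute)
        qed
      qed (use uv in auto)
      then show "norm (y v - y u) \<le> c * (v - u)" using uv by simp
    qed
  qed
  have V_der: "AE s in lborel. s \<in> {t<..<T} \<longrightarrow> (V y has_vector_derivative 0) (at s)"
  proof -
    have "AE s in lborel. s \<in> {t<..<T} \<longrightarrow> (V y has_vector_derivative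
       2 * (f s \<bullet> (matrix_inv (Q s) *v y s)) + 2 * ((K s *v (Hinv s *v y s)) \<bullet> (S s *v (Hinv s *v y s)))) (at s)"
      using t y_at by (intro V_AE_derivative) auto
    then show ?thesis
    proof eventually_elim
      case (elim s)
      have "f s \<bullet> (matrix_inv (Q s) *v y s) = - ((K s *v w s) \<bullet> (S s *v w s))" if "s \<in> {t<..<T}"
      proof -
        have s: "s \<in> {0..T}" using that t by auto
        have "H s *v (matrix_inv (Q s) *v y s) = w s"
          by (simp add: w_def msqrt_minvsqrt[OF Q_pd[OF s]] flip: minvsqrt_apply[OF Q_pd[OF s]])
        then have "(H s *v (K s *v (S s *v w s))) \<bullet> (matrix_inv (Q s) *v y s) = (K s *v (S s *v w s)) \<bullet> w s"
          by (simp only: inner_symmetric[OF transpose_msqrt[OF pd_imp_psd[OF Q_pd[OF s]]]])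
        also have "\<dots> = (K s *v w s) \<bullet> (S s *v w s)"
          using K_sym[OF s, of "S s *v w s" "w s"] by (simp only: inner_commute)
        finally show ?thesis by (simp add: f_def)
      qed
      then show ?case using elim by (auto simp: w_def)
    qed
  qed
  \<comment> \<open>The bound is needed at every time and not only at \<open>T\<close>: it gives
    \<open>norm (w s) \<le> 1\<close>, on which the energy bound for the control at time
    \<open>s\<close> depends.\<close>
  have V_le: "V y s \<le> 1" if s: "s \<in> {t..T}" for s
  proof -
    have ac: "abs_continuous_on t s (V y)"
      by (rule abs_continuous_on_subinterval[OF V_abs_continuous[OF _ y_ac]]) (use s t in auto)
    have neg: "abs_continuous_on t s (\<lambda>r. - V y r)"
      by (rule abs_continuous_on_dominated[OF ac ac, where C=1]) (simp add: abs_minus_commute)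
    have "AE r in lborel. r \<in> {t<..<s} \<longrightarrow> (\<exists>d\<ge>0. ((\<lambda>r. - V y r) has_vector_derivative d) (at r))"
      using V_der
    proof eventually_elim
      case (elim r)
      then show ?case using s has_vector_derivative_minus[of "V y" 0 "at r"] by auto
    qed
    from abs_continuous_on_mono[OF _ neg this] have "V y s \<le> V y t" using s by simp
    also have "V y t \<le> 1" using x y(1) by (simp add: V_def ellipsoid_def)
    finally show ?thesis .
  qed
  have w_le: "norm (w s) \<le> 1" if "s \<in> {t..T}" for s
  proof -
    have "s \<in> {0..T}" using that sub by blast
    from V_le[OF that] have "(norm (w s))\<^sup>2 \<le> 1" unfolding V_eq_norm[OF \<open>s \<in> {0..T}\<close>] w_def .
    then show ?thesis by (simp add: power_le_one_iff abs_square_le_1)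
  qed
  have "\<exists>\<mu>. B s *v (P *v (transpose (B s) *v \<mu>)) = f s \<and>
    (transpose (B s) *v \<mu>) \<bullet> (P *v (transpose (B s) *v \<mu>)) \<le> 1" if "s \<in> {t..T}" for s
    using feedback_multiplier_exists[of s "w s"] w_le[OF that] that sub unfolding f_def by blast
  \<comment> \<open>A choice made separately at each time; measurability is recovered for
    \<open>v\<close> below, not for \<open>\<mu>\<close>.\<close>
  then obtain \<mu> where \<mu>: "\<And>s. s \<in> {t..T} \<Longrightarrow> B s *v (P *v (transpose (B s) *v \<mu> s)) = f s"
    "\<And>s. s \<in> {t..T} \<Longrightarrow> (transpose (B s) *v \<mu> s) \<bullet> (P *v (transpose (B s) *v \<mu> s)) \<le> 1"
    by metis
  define v where "v s = P *v (transpose (B s) *v \<mu> s)" for s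
  have v_meas: "v \<in> borel_measurable (lebesgue_on {t..T})"
    unfolding v_def using \<mu>(1)
    by (intro minimal_energy_control_measurable[OF pd_imp_psd[OF P_pd] continuous_on_subset[OF B_cont sub] f_cont])
  have u: "admissible (ellipsoid p P) t T (\<lambda>s. p + v s)"
    unfolding admissible_def
  proof (intro conjI ballI)
    show "(\<lambda>s. p + v s) \<in> borel_measurable (lebesgue_on {t..T})"
      using v_meas by (intro borel_measurable_add) auto
    fix s assume "s \<in> {t..T}"
    then show "p + v s \<in> ellipsoid p P"
      using \<mu>(2)[of s] by (simp add: ellipsoid_def v_def matrix_inv_apply pd_invertible P_pd inner_commute)
  qed
  have sol_x: "sys_solution A B (\<lambda>s. p + v s) t T (\<lambda>s. q s + y s)"
    unfolding sys_solution_def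
  proof
    show "abs_continuous_on t T (\<lambda>s. q s + y s)"
      using sol t y_ac unfolding fvp_solution_def
      by (intro abs_continuous_on_add) (auto intro: abs_continuous_on_subinterval)
    have "AE s in lborel. s \<in> {0<..<T} \<longrightarrow> (q has_vector_derivative A s *v q s + B s *v p) (at s)"
      using sol by (auto simp: fvp_solution_def elim: AE_mp)
    then show "AE s in lborel. s \<in> {t<..<T} \<longrightarrow>
        ((\<lambda>s. q s + y s) has_vector_derivative A s *v (q s + y s) + B s *v (p + v s)) (at s)"
    proof eventually_elim
      case (elim s)
      show ?case
      proof
        assume s: "s \<in> {t<..<T}"
        have "((\<lambda>s. q s + y s) has_vector_derivative (A s *v q s + B s *v p) + (A s *v y s + f s)) (at s)"
          using elim s t by (intro has_vector_derivative_add y_at) auto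
        moreover have "B s *v v s = f s" using \<mu>(1)[of s] s by (simp add: v_def)
        ultimately show "((\<lambda>s. q s + y s) has_vector_derivative A s *v (q s + y s) + B s *v (p + v s)) (at s)"
          by (simp add: matrix_vector_right_distrib algebra_simps)
      qed
    qed
  qed
  have "q T + y T \<in> ellipsoid xe Xe"
  proof -
    have "q T = xe" "Q T = Xe" using sol by (auto simp: fvp_solution_def)
    then show ?thesis using V_le[of T] tT by (simp add: V_def ellipsoid_def)
  qed
  then show "x \<in> reach_set A B (ellipsoid p P) (ellipsoid xe Xe) T t"
    unfolding reach_set_def using u sol_x y(1) by force
qed

section \<open>Trajectories under the alignment condition\<close>

lemma V_rate_nonneg:
  assumes s: "s \<in> {0..T}" and u: "u \<in> ellipsoid p P" and V: "1 \<le> V y s"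
    and aligned: "K s *v (Hinv s *v y s) \<noteq> 0 \<Longrightarrow>
        (1 / norm (Hinv s *v y s)) *\<^sub>R (S s *v (Hinv s *v y s)) =
        (1 / norm (K s *v (Hinv s *v y s))) *\<^sub>R (K s *v (Hinv s *v y s))"
  shows "0 \<le> 2 * ((B s *v (u - p)) \<bullet> (matrix_inv (Q s) *v y s)) +
    2 * ((K s *v (Hinv s *v y s)) \<bullet> (S s *v (Hinv s *v y s)))"
proof -
  define w where "w = Hinv s *v y s"
  define z where "z = matrix_inv (Q s) *v y s"
  have z: "Hinv s *v w = z" by (simp add: w_def z_def minvsqrt_apply[OF Q_pd[OF s]])
  \<comment> \<open>Used twice: \<open>w\<close> can be cancelled in the alignment condition, and
    the factor \<open>norm w\<close> lets the tube term outweigh the control term.\<close>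
  have w1: "1 \<le> norm w"
    using V unfolding V_eq_norm[OF s] w_def[symmetric] by (metis norm_ge_zero one_power2 power2_le_imp_le)
  \<comment> \<open>Equality in Cauchy-Schwarz. Where \<open>K s *v w\<close> vanishes both sides
    are 0, so alignment is required only elsewhere.\<close>
  have KS: "(K s *v w) \<bullet> (S s *v w) = norm (K s *v w) * norm w"
  proof (cases "K s *v w = 0")
    case False
    have "w \<noteq> 0" using w1 by auto
    from False have "norm w *\<^sub>R ((1 / norm w) *\<^sub>R (S s *v w)) = norm w *\<^sub>R ((1 / norm (K s *v w)) *\<^sub>R (K s *v w))"
      using aligned unfolding w_def by simp
    then have "S s *v w = (norm w / norm (K s *v w)) *\<^sub>R (K s *v w)" using \<open>w \<noteq> 0\<close> by simp
    then show ?thesis using False by (simp add: dot_square_norm power2_eq_square)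
  qed simp
  have "\<bar>(transpose (B s) *v z) \<bullet> (u - p)\<bar> \<le> sqrt ((transpose (B s) *v z) \<bullet> (P *v (transpose (B s) *v z)))"
    using u by (intro inner_le_dual_norms[OF P_pd]) (simp add: ellipsoid_def)
  also have "\<dots> = norm (K s *v w)" using norm_K[OF s, of w] by (simp add: z real_sqrt_unique)
  finally have "\<bar>z \<bullet> (B s *v (u - p))\<bar> \<le> norm (K s *v w)" unfolding inner_transpose' .
  then have "- norm (K s *v w) \<le> (B s *v (u - p)) \<bullet> z" unfolding inner_commute[of z] by linarith
  moreover have "norm (K s *v w) \<le> norm (K s *v w) * norm w"
    using w1 mult_left_mono[of 1 "norm w" "norm (K s *v w)"] by simp
  ultimately show ?thesis using KS unfolding w_def[symmetric] z_def[symmetric] by simp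
qed

lemma aligned_trajectory_in_ellipsoid:
  assumes t: "t \<in> {0..T}" and u: "admissible (ellipsoid p P) t T u"
    and x: "sys_solution A B u t T x" and xT: "x T \<in> ellipsoid xe Xe"
  defines "y \<equiv> \<lambda>s. x s - q s"
  assumes aligned: "\<And>s. s \<in> {t..T} \<Longrightarrow> K s *v (Hinv s *v y s) \<noteq> 0 \<Longrightarrow>
        (1 / norm (Hinv s *v y s)) *\<^sub>R (S s *v (Hinv s *v y s)) =
        (1 / norm (K s *v (Hinv s *v y s))) *\<^sub>R (K s *v (Hinv s *v y s))"
  shows "x t \<in> ellipsoid (q t) (Q t)"
proof (rule ccontr)
  assume "x t \<notin> ellipsoid (q t) (Q t)"
  then have Vt: "V y t > 1" by (simp add: ellipsoid_iff_V y_def)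
  have VT: "V y T \<le> 1"
    using xT sol by (simp add: V_def ellipsoid_def y_def fvp_solution_def)
  have y_ac: "abs_continuous_on t T y"
    unfolding y_def using x sol t unfolding sys_solution_def fvp_solution_def
    by (intro abs_continuous_on_diff) (auto intro: abs_continuous_on_subinterval)
  have V_ac: "abs_continuous_on t T (V y)" using t y_ac by (intro V_abs_continuous) auto
  then have V_cont: "continuous_on {t..T} (V y)" by (rule abs_continuous_on_imp_continuous_on)
  \<comment> \<open>Its least element \<open>r\<close> is the first time at which \<open>V\<close>
    is at most 1. Before \<open>r\<close> the value exceeds 1, so the sign of the derivative is
    known on the whole of the interval from \<open>t\<close> to \<open>r\<close>, which gives
    \<open>V y t \<le> V y r\<close>.\<close>
  define Z where "Z = {s \<in> {t..T}. V y s \<le> 1}"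
  have "T \<in> Z" using VT t by (simp add: Z_def)
  have "Z = {t..T} \<inter> V y -` {..1}" by (auto simp: Z_def)
  then have "closed Z" by (simp add: continuous_closed_preimage[OF V_cont])
  moreover have "bounded Z" by (rule bounded_subset[of "{t..T}"]) (auto simp: Z_def)
  ultimately have "compact Z" by (simp add: compact_eq_bounded_closed)
  then obtain r where r: "r \<in> Z" "\<And>s. s \<in> Z \<Longrightarrow> r \<le> s"
    using compact_attains_inf[of Z] \<open>T \<in> Z\<close> by blast
  have rT: "t \<le> r" "r \<le> T" using r(1) by (auto simp: Z_def)
  have y': "AE s in lborel. s \<in> {t<..<T} \<longrightarrow> (y has_vector_derivative A s *v y s + B s *v (u s - p)) (at s)"
  proof -
    have "AE s in lborel. s \<in> {0<..<T} \<longrightarrow> (q has_vector_derivative A s *v q s + B s *v p) (at s)"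
      using sol by (auto simp: fvp_solution_def elim: AE_mp)
    moreover have "AE s in lborel. s \<in> {t<..<T} \<longrightarrow> (x has_vector_derivative A s *v x s + B s *v u s) (at s)"
      using x by (simp add: sys_solution_def)
    ultimately show ?thesis
    proof eventually_elim
      case (elim s)
      show ?case
      proof
        assume "s \<in> {t<..<T}"
        then have "(y has_vector_derivative (A s *v x s + B s *v u s) - (A s *v q s + B s *v p)) (at s)"
          unfolding y_def using elim t by (intro has_vector_derivative_diff) auto
        then show "(y has_vector_derivative A s *v y s + B s *v (u s - p)) (at s)"
          by (simp add: y_def matrix_vector_mult_diff_distrib algebra_simps)
      qed
    qed
  qed
  have t0: "0 \<le> t" using t by simp
  from V_AE_derivative[OF t0 y']
  have "AE s in lborel. s \<in> {t<..<r} \<longrightarrow> (\<exists>d\<ge>0. (V y has_vector_derivative d) (at s))"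
  proof eventually_elim
    case (elim s)
    show ?case
    proof
      assume s: "s \<in> {t<..<r}"
      then have sT: "s \<in> {t..T}" "s \<in> {0..T}" "s \<in> {t<..<T}" using rT t by auto
      have "s \<notin> Z" using r(2)[of s] s by auto
      then have "1 \<le> V y s" using sT(1) by (simp add: Z_def)
      moreover have "u s \<in> ellipsoid p P" using u sT(1) by (simp add: admissible_def)
      ultimately have "0 \<le> 2 * ((B s *v (u s - p)) \<bullet> (matrix_inv (Q s) *v y s)) +
          2 * ((K s *v (Hinv s *v y s)) \<bullet> (S s *v (Hinv s *v y s)))"
        using aligned[OF sT(1)] by (intro V_rate_nonneg[OF sT(2)])
      then show "\<exists>d\<ge>0. (V y has_vector_derivative d) (at s)"
        using elim sT(3) by blast
    qed
  qed
  then have "V y t \<le> V y r"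
    by (rule abs_continuous_on_mono[OF rT(1) abs_continuous_on_subinterval[OF V_ac order_refl rT(2)]])
  then show False using Vt r(1) by (simp add: Z_def)
qed

end

section \<open>Union over the family of tubes\<close>

theorem theorem5:
  fixes T :: real
    and A :: "real \<Rightarrow> real^'n^'n" and B :: "real \<Rightarrow> real^'m^'n"
    and p :: "real^'m" and P :: "real^'m^'m"
    and xe :: "real^'n" and Xe :: "real^'n^'n"
    and nq :: nat
    and S :: "nat \<Rightarrow> real \<Rightarrow> real^'n^'n"
    and q :: "nat \<Rightarrow> real \<Rightarrow> real^'n" and Q :: "nat \<Rightarrow> real \<Rightarrow> real^'n^'n"
  assumes T_pos: "T > 0"
    and A_cont: "continuous_on {0..T} A"
    and B_cont: "continuous_on {0..T} B"
    and P_pd: "pd P"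
    and Xe_pd: "pd Xe"
    and S_cont: "\<And>i. i \<in> {1..nq} \<Longrightarrow> continuous_on {0..T} (S i)"
    and S_orth: "\<And>i t. i \<in> {1..nq} \<Longrightarrow> t \<in> {0..T} \<Longrightarrow> orthogonal_matrix (S i t)"
    and sol: "\<And>i. i \<in> {1..nq} \<Longrightarrow> fvp_solution A B p P xe Xe (S i) T (q i) (Q i)"
    and sol_pd: "\<And>i t. i \<in> {1..nq} \<Longrightarrow> t \<in> {0..T} \<Longrightarrow> pd (Q i t)"
    and sol_unique: "\<And>i q' Q'. i \<in> {1..nq} \<Longrightarrow> fvp_solution A B p P xe Xe (S i) T q' Q' \<Longrightarrow>
                       (\<forall>t\<in>{0..T}. pd (Q' t)) \<Longrightarrow> (\<forall>t\<in>{0..T}. q' t = q i t \<and> Q' t = Q i t)"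
  shows "(\<forall>t\<in>{0..T}. (\<Union>i\<in>{1..nq}. ellipsoid (q i t) (Q i t))
            \<subseteq> reach_set A B (ellipsoid p P) (ellipsoid xe Xe) T t)
       \<and> (\<forall>t\<in>{0..T}. \<forall>ustar xstar. \<forall>i\<in>{1..nq}.
            admissible (ellipsoid p P) t T ustar \<longrightarrow>
            sys_solution A B ustar t T xstar \<longrightarrow>
            xstar T \<in> ellipsoid xe Xe \<longrightarrow>
            (\<forall>s\<in>{t..T}.
               let w = minvsqrt (Q i s) *v (xstar s - q i s);
                   Qs = Qstar B P s (Q i s)
               in msqrt Qs *v w \<noteq> 0 \<longrightarrow>
                  (1 / norm w) *\<^sub>R (S i s *v w) = (1 / norm (msqrt Qs *v w)) *\<^sub>R (msqrt Qs *v w))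
            \<longrightarrow> xstar t \<in> ellipsoid (q i t) (Q i t)
                \<and> ellipsoid (q i t) (Q i t) \<subseteq> (\<Union>j\<in>{1..nq}. ellipsoid (q j t) (Q j t)))"
proof -
  have tube: "ellipsoidal_tube T A B p P xe Xe (S i) (q i) (Q i)" if "i \<in> {1..nq}" for i
    using A_cont B_cont P_pd S_cont[OF that] S_orth[OF that] sol[OF that] sol_pd[OF that]
    by unfold_locales
  show ?thesis
  proof (intro conjI ballI allI impI)
    fix t assume "t \<in> {0..T}"
    then show "(\<Union>i\<in>{1..nq}. ellipsoid (q i t) (Q i t))
        \<subseteq> reach_set A B (ellipsoid p P) (ellipsoid xe Xe) T t"
      using ellipsoidal_tube.ellipsoid_subset_reach_set[OF tube] by blast
  next
    fix t ustar xstar i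
    assume "t \<in> {0..T}" and i: "i \<in> {1..nq}"
      and "admissible (ellipsoid p P) t T ustar" "sys_solution A B ustar t T xstar"
      and "xstar T \<in> ellipsoid xe Xe"
      and aligned: "\<forall>s\<in>{t..T}.
               let w = minvsqrt (Q i s) *v (xstar s - q i s);
                   Qs = Qstar B P s (Q i s)
               in msqrt Qs *v w \<noteq> 0 \<longrightarrow>
                  (1 / norm w) *\<^sub>R (S i s *v w) = (1 / norm (msqrt Qs *v w)) *\<^sub>R (msqrt Qs *v w)"
    then show "xstar t \<in> ellipsoid (q i t) (Q i t)"
      using aligned[unfolded Let_def]
      by (intro ellipsoidal_tube.aligned_trajectory_in_ellipsoid[OF tube[OF i]]) auto
  qed blast
qed

end
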